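(* Let $N$ be a positive integer and let $\rho_{(1)}(x)$ be the eigenvalue density of the Gaussian symplectic ensemble (see context). Then $\rho_{(1)}$ satisfies on $\mathbb{R}$ the fifth order linear homogeneous differential equation $$-\tfrac14\rho_{(1)}^{(V)}+5\left[\tfrac14x^2-\left(N+\tfrac14\right)\right]\rho_{(1)}'''-\tfrac32x\rho_{(1)}''+\left[-x^4+(8N+2)x^2-16N^2-8N+\tfrac12\right]\rho_{(1)}'+x\left[x^2-(4N+1)\right]\rho_{(1)}=0.$$
   Context: Consider the probability law on $(\lambda_1,\dots,\lambda_N)\in\mathbb{R}^N$ with density proportional to $\prod_{l=1}^Ne^{-\lambda_l^2}\prod_{1\le j<k\le N}|\lambda_k-\lambda_j|^4$ (GSE, $\beta=4$). The eigenvalue density $\rho_{(1)}$ is the function such that $\int_a^b\rho_{(1)}(x)\,dx$ is the expected number of $\lambda_j$ in $[a,b]$; in particular $\int_{-\infty}^\infty\rho_{(1)}(x)\,dx=N$. *)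

theory Defs
  imports "HOL-Probability.Probability"
begin

definition gse_weight :: "nat \<Rightarrow> (nat \<Rightarrow> real) \<Rightarrow> real" where
  "gse_weight N l =
     (\<Prod>j<N. exp (- (l j)\<^sup>2)) * (\<Prod>k<N. \<Prod>j<k. \<bar>l k - l j\<bar> ^ 4)"

definition gse_partition_function :: "nat \<Rightarrow> real" where
  "gse_partition_function N =
     (\<integral>l. gse_weight N l \<partial>(\<Pi>\<^sub>M j\<in>{..<N}. lborel))"

text \<open>Points of \<open>\<real>\<^sup>N\<close> are functions on \<open>{..<N}\<close>, so the paper's
  eigenvalues with indices \<open>1, \<dots>, N\<close> have indices \<open>0, \<dots>, N - 1\<close> here.\<close>

definition gse :: "nat \<Rightarrow> (nat \<Rightarrow> real) measure" where
  "gse N = density (\<Pi>\<^sub>M j\<in>{..<N}. lborel)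
     (\<lambda>l. ennreal (gse_weight N l / gse_partition_function N))"

definition gse_expected_count :: "nat \<Rightarrow> real \<Rightarrow> real \<Rightarrow> real" where
  "gse_expected_count N a b =
     (\<integral>l. real (card {j. j < N \<and> l j \<in> {a..b}}) \<partial>(gse N))"

text \<open>The integrals over intervals determine a density only almost everywhere.
  The eigenvalue density is the unique continuous representative.\<close>

definition gse_density :: "nat \<Rightarrow> real \<Rightarrow> real" where
  "gse_density N = (THE \<rho>. continuous_on UNIV \<rho> \<and>
     (\<forall>a b. a \<le> b \<longrightarrow> (\<rho> has_integral gse_expected_count N a b) {a..b}))"

end

(*
  Write N = m + 1 and n = 2 N. Hermite interpolation at the double nodes l_0, ..., l_m,
  multiplied by the weight and integrated, says that the antisymmetric polynomial kernel
    S(x,y) = (y - x) * E[prod_{j<m} (x - l_j)^2 (y - l_j)^2]   (expectation under the weight for m)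
  reproduces polynomials of degree < n under the skew form int (q p' - q' p) exp(-y^2) dy, up to
  a constant. The density is the diagonal derivative of S times exp(-x^2). After an integration
  by parts the reproducing property is an orthogonality statement, which determines S in terms of
  the Hermite kernel and one more polynomial C with (C exp(-x^2/2))' = H_{n-1} exp(-x^2/2). With
    a = H_n exp(-x^2/2), b = H_{n-1} exp(-x^2/2), c = C exp(-x^2/2)
  the density becomes a constant multiple of 2 n b^2 - 2 x a b + a^2 + a c. Since
    a' = 2 n b - x a, b' = x b - a, c' = b,
  all its derivatives are combinations of a^2, ab, b^2, ac, bc with polynomial coefficients,
  and the differential equation is a linear relation between them.
*)

theory Submission
  imports Defs "HOL-Computational_Algebra.Polynomial" "HOL-Combinatorics.Transposition"
begin

section \<open>The differential equation of the quadratic form\<close>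

text \<open>The system for a, b, c maps the span of a^2, ab, b^2, ac, bc over polynomials in x into
  itself, so five derivatives can be computed there and compared. As \<open>deriv\<close> is total,
  the differentiability clause certifies that the iterated derivatives are genuine.\<close>

lemma fifth_order_ode_of_quadratic_form:
  fixes a b c r :: "real \<Rightarrow> real" and N \<kappa> :: real
  assumes a: "\<And>x. (a has_real_derivative 4 * N * b x - x * a x) (at x)"
    and b: "\<And>x. (b has_real_derivative x * b x - a x) (at x)"
    and c: "\<And>x. (c has_real_derivative b x) (at x)"
    and r: "\<And>x. r x = \<kappa> * (4 * N * (b x)\<^sup>2 - 2 * x * a x * b x + (a x)\<^sup>2 + a x * c x)"
  shows "(\<forall>k<5. \<forall>x. (deriv ^^ k) r differentiable (at x)) \<and>
    (\<forall>x. - (1/4) * (deriv ^^ 5) r x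
      + 5 * (1/4 * x^2 - (N + 1/4)) * (deriv ^^ 3) r x
      - 3/2 * x * (deriv ^^ 2) r x
      + (- (x^4) + (8 * N + 2) * x^2 - 16 * N^2 - 8 * N + 1/2) * deriv r x
      + x * (x^2 - (4 * N + 1)) * r x = 0)"
proof -
  \<comment> \<open>Each of \<open>r1\<close> to \<open>r5\<close> is the previous function
    differentiated, with a', b', c' eliminated. In \<open>r1\<close> everything cancels except - a b
    + a' c.\<close>
  define r1 where "r1 x = \<kappa> * (- a x * b x + (4 * N * b x - x * a x) * c x)" for x
  define r2 where "r2 x = \<kappa> * ((a x)\<^sup>2 - x * a x * b x + (x^2 - 4 * N - 1) * a x * c x)" for x
  define r3 where "r3 x = \<kappa> * ((x^2 + 4 * N - 2) * a x * b x - 4 * N * x * (b x)\<^sup>2 - x * (a x)\<^sup>2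
    + (3 * x - x^3 + 4 * N * x) * a x * c x
    + 4 * N * (x^2 - 4 * N - 1) * b x * c x)" for x
  define r4 where "r4 x = \<kappa> * ((3 - 6 * x^2 + 8 * N + x^4 - 8 * N * x^2 + 16 * N^2) * a x * c x
    - 16 * N * (b x)\<^sup>2 + (5 * x - x^3 + 4 * N * x) * a x * b x
    + 16 * N * x * b x * c x + (1 + x^2 - 4 * N) * (a x)\<^sup>2)" for x
  define r5 where "r5 x = \<kappa> * ((8 - 9 * x^2 + 52 * N + x^4 - 16 * N^2) * a x * b x
    + (28 * N - 8 * N * x^2 + 32 * N^2 + 4 * N * x^4 - 32 * N^2 * x^2 + 64 * N^3) * b x * c x
    + (- 15 * x + 10 * x^3 - 40 * N * x - x^5 + 8 * N * x^3 - 16 * N^2 * x) * a x * c x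
    + (4 * N * x - 5 * x - x^3) * (a x)\<^sup>2
    + (4 * N * x - 4 * N * x^3 + 16 * N^2 * x) * (b x)\<^sup>2)" for x
  note D = derivative_eq_intros a b c
  have d0: "(r has_real_derivative r1 x) (at x)" for x
    unfolding r r1_def
    by (rule D refl | simp)+ (simp add: algebra_simps power2_eq_square)
  have d1: "(r1 has_real_derivative r2 x) (at x)" for x
    unfolding r1_def[abs_def] r2_def
    by (rule D refl | simp)+ (simp add: algebra_simps power2_eq_square)
  have d2: "(r2 has_real_derivative r3 x) (at x)" for x
    unfolding r2_def[abs_def] r3_def
    by (rule D refl | simp)+ (simp add: algebra_simps power2_eq_square power3_eq_cube)
  have d3: "(r3 has_real_derivative r4 x) (at x)" for x
    unfolding r3_def[abs_def] r4_def
    by (rule D refl | simp)+ (simp add: algebra_simps eval_nat_numeral)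
  have d4: "(r4 has_real_derivative r5 x) (at x)" for x
    unfolding r4_def[abs_def] r5_def
    by (rule D refl | simp)+ (simp add: algebra_simps eval_nat_numeral)
  have e: "deriv r = r1" "deriv r1 = r2" "deriv r2 = r3" "deriv r3 = r4" "deriv r4 = r5"
    using d0 d1 d2 d3 d4 by (auto intro!: ext DERIV_imp_deriv)
  have diff: "(deriv ^^ k) r differentiable (at x)" if "k < 5" for k x
  proof -
    have "k = 0 \<or> k = 1 \<or> k = 2 \<or> k = 3 \<or> k = 4" using that by auto
    moreover have "r differentiable (at x)" "r1 differentiable (at x)" "r2 differentiable (at x)"
      "r3 differentiable (at x)" "r4 differentiable (at x)"
      using d0 d1 d2 d3 d4 by (blast intro: real_differentiable_def[THEN iffD2])+
    ultimately show ?thesis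
      by (elim disjE) (simp_all add: eval_nat_numeral e)
  qed
  \<comment> \<open>A polynomial identity: the coefficient of each of the five products vanishes
    separately.\<close>
  have "- (1/4) * r5 x + 5 * (1/4 * x^2 - (N + 1/4)) * r3 x - 3/2 * x * r2 x
      + (- (x^4) + (8 * N + 2) * x^2 - 16 * N^2 - 8 * N + 1/2) * r1 x
      + x * (x^2 - (4 * N + 1)) * r x = 0" for x
    unfolding r r1_def r2_def r3_def r5_def
    by (simp add: field_simps) (simp add: algebra_simps eval_nat_numeral)
  with diff show ?thesis
    by (simp add: eval_nat_numeral e)
qed

section \<open>Hermite polynomials and the Gaussian functional\<close>

lemma pderiv_sum: "pderiv (\<Sum>i\<in>A. f i) = (\<Sum>i\<in>A. pderiv (f i))"
  by (induction A rule: infinite_finite_induct) (auto simp: pderiv_add)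

lemma smult_sum_right: "smult t (\<Sum>i\<in>A. f i) = (\<Sum>i\<in>A. smult t (f i))"
  by (induction A rule: infinite_finite_induct) (auto simp: smult_add_right)

text \<open>Physicists' Hermite polynomials, generated by the raising operator adjoint to
  differentiation under exp(-x^2); in this form orthogonality is an integration by parts.\<close>

fun hermite :: "nat \<Rightarrow> real poly" where
  "hermite 0 = 1"
| "hermite (Suc k) = [:0, 2:] * hermite k - pderiv (hermite k)"

lemma pderiv_hermite: "pderiv (hermite (Suc k)) = smult (2 * real (Suc k)) (hermite k)"
proof (induction k)
  case 0
  show ?case by (simp add: pderiv_pCons)
next
  case (Suc k)
  have "pderiv (hermite (Suc (Suc k))) =
      smult 2 (hermite (Suc k)) + [:0, 2:] * pderiv (hermite (Suc k))
      - pderiv (pderiv (hermite (Suc k)))"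
    by (simp only: hermite.simps(2)[of "Suc k"] pderiv_diff pderiv_mult)
       (simp add: pderiv_pCons algebra_simps del: hermite.simps)
  also have "\<dots> = smult 2 (hermite (Suc k)) + smult (2 * real (Suc k)) ([:0, 2:] * hermite k - pderiv (hermite k))"
    unfolding Suc.IH by (simp add: pderiv_smult algebra_simps smult_diff_right del: hermite.simps)
  also have "\<dots> = smult (2 * real (Suc (Suc k))) (hermite (Suc k))"
    by (simp add: smult_add_left [symmetric] del: mult_pCons_left) 
  finally show ?case .
qed

lemma hermite_recurrence:
  "hermite (Suc (Suc k)) = [:0, 2:] * hermite (Suc k) - smult (2 * real (Suc k)) (hermite k)"
  by (subst hermite.simps(2)) (simp only: pderiv_hermite)

lemma degree_hermite_le: "degree (hermite k) \<le> k"
proof (induction k)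
  case (Suc k)
  have "degree ([:0, 2:] * hermite k) \<le> Suc k"
    using degree_mult_le[of "[:0, 2::real:]" "hermite k"] Suc by simp
  moreover have "degree (pderiv (hermite k)) \<le> Suc k"
    using Suc by (simp add: degree_pderiv)
  ultimately show ?case
    by (simp add: degree_diff_le del: mult_pCons_left)
qed simp

lemma coeff_hermite: "coeff (hermite k) k = 2 ^ k"
proof (induction k)
  case (Suc k)
  have "coeff (pderiv (hermite k)) (Suc k) = 0"
    using degree_hermite_le[of k] by (intro coeff_eq_0) (simp add: degree_pderiv)
  with Suc show ?case by simp
qed simp

section \<open>Gaussian moments and integration by parts\<close>

lemma gaussian_monomial_integrable: "integrable lborel (\<lambda>x::real. x ^ k * exp (- x\<^sup>2))"
  and gaussian_monomial_integral_even:
    "(\<integral>x. x ^ (2 * j) * exp (- x\<^sup>2) \<partial>lborel) = sqrt pi * fact (2 * j) / (4 ^ j * fact j)"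
  and gaussian_monomial_integral_odd:
    "(\<integral>x. x ^ (2 * j + 1) * exp (- x\<^sup>2) \<partial>lborel) = (0::real)"
proof -
  have s: "0 < 1 / sqrt (2::real)" by simp
  \<comment> \<open>exp(-x^2) is sqrt pi times the centred normal density of variance 1/2.\<close>
  have e: "x ^ i * exp (- x\<^sup>2) = sqrt pi * (normal_density 0 (1 / sqrt 2) x * (x - 0) ^ i)" for x :: real and i
    by (simp add: normal_density_def power_divide)
  show "integrable lborel (\<lambda>x::real. x ^ k * exp (- x\<^sup>2))"
    unfolding e by (intro integrable_mult_right integrable_normal_moment s)
  show "(\<integral>x. x ^ (2 * j) * exp (- x\<^sup>2) \<partial>lborel) = sqrt pi * fact (2 * j) / (4 ^ j * fact j)"
    unfolding e integral_mult_right_zero integral_normal_moment_even[OF s]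
    by (simp add: power_divide)
  show "(\<integral>x. x ^ (2 * j + 1) * exp (- x\<^sup>2) \<partial>lborel) = (0::real)"
    using integral_normal_moment_odd[OF s, of 0 j] by (simp only: e integral_mult_right_zero mult_zero_right)
qed

lemma gaussian_poly_integrable: "integrable lborel (\<lambda>x::real. poly p x * exp (- x\<^sup>2))"
  unfolding poly_altdef sum_distrib_right mult.assoc
  by (intro Bochner_Integration.integrable_sum integrable_mult_right gaussian_monomial_integrable)

definition gauss :: "real poly \<Rightarrow> real" where
  "gauss p = (\<integral>x. poly p x * exp (- x\<^sup>2) \<partial>lborel)"

lemma gauss_add: "gauss (p + q) = gauss p + gauss q"
  by (simp add: gauss_def distrib_right Bochner_Integration.integral_add gaussian_poly_integrable)

lemma gauss_smult: "gauss (smult t p) = t * gauss p"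
  by (simp add: gauss_def mult.assoc)

lemma gauss_0: "gauss 0 = 0"
  by (simp add: gauss_def)

lemma gauss_diff: "gauss (p - q) = gauss p - gauss q"
  using gauss_add[of "p - q" q] by simp

lemma gauss_sum: "gauss (\<Sum>i\<in>A. f i) = (\<Sum>i\<in>A. gauss (f i))"
  by (induction A rule: infinite_finite_induct) (auto simp: gauss_0 gauss_add)

text \<open>Integration by parts on monomials, read off from the moments instead of boundary terms:
  for even \<open>k\<close> both sides are 0, for odd \<open>k\<close> they compare consecutive even
  moments.\<close>

lemma gauss_monom_recurrence: "gauss (pderiv (monom 1 k)) = gauss ([:0, 2:] * monom 1 k)"
proof (cases "even k")
  case True
  then obtain j where k: "k = 2 * j" by auto
  have 1: "gauss ([:0, 2:] * monom 1 k) = 2 * (\<integral>x. x ^ (2 * j + 1) * exp (- x\<^sup>2) \<partial>lborel)"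
    by (simp add: gauss_def poly_monom k ac_simps del: mult_pCons_left flip: integral_mult_right_zero)
  have 2: "gauss (pderiv (monom 1 k)) = 0"
  proof (cases j)
    case (Suc i)
    have "gauss (pderiv (monom 1 k)) = real k * (\<integral>x. x ^ (2 * i + 1) * exp (- x\<^sup>2) \<partial>lborel)"
      by (simp add: gauss_def pderiv_monom poly_monom k Suc mult.assoc del: of_nat_mult flip: integral_mult_right_zero)
    then show ?thesis unfolding gaussian_monomial_integral_odd by simp
  qed (simp add: k gauss_def)
  show ?thesis
    unfolding 1 2 gaussian_monomial_integral_odd by simp
next
  case False
  then obtain j where k: "k = 2 * j + 1" by (auto elim: oddE)
  have 1: "gauss ([:0, 2:] * monom 1 k) = 2 * (\<integral>x. x ^ (2 * (j + 1)) * exp (- x\<^sup>2) \<partial>lborel)"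
    by (simp add: gauss_def poly_monom k ac_simps del: mult_pCons_left flip: integral_mult_right_zero)
  have 2: "gauss (pderiv (monom 1 k)) = real k * (\<integral>x. x ^ (2 * j) * exp (- x\<^sup>2) \<partial>lborel)"
    by (simp add: gauss_def pderiv_monom poly_monom k mult.assoc del: of_nat_mult flip: integral_mult_right_zero)
  have 3: "fact (2 * (j + 1)) = (2 * (real j + 1)) * (2 * real j + 1) * fact (2 * j)"
    by (simp add: algebra_simps)
  have 4: "fact (j + 1) = (real j + 1) * fact j" by (simp add: algebra_simps)
  have 5: "real k = 2 * real j + 1" by (simp add: k)
  show ?thesis
    unfolding 1 2 gaussian_monomial_integral_even 3 4 5
    by (simp add: divide_simps)
qed

lemma gauss_pderiv: "gauss (pderiv p) = gauss ([:0, 2:] * p)"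
proof -
  have p: "p = (\<Sum>i\<le>degree p. smult (coeff p i) (monom 1 i))"
    by (simp add: smult_monom poly_as_sum_of_monoms)
  have "gauss (pderiv p) = (\<Sum>i\<le>degree p. coeff p i * gauss (pderiv (monom 1 i)))"
    by (subst p) (simp add: pderiv_sum pderiv_smult gauss_sum gauss_smult)
  also have "\<dots> = gauss ([:0, 2:] * p)"
    by (subst (3) p) (simp only: gauss_monom_recurrence sum_distrib_left mult_smult_right gauss_sum gauss_smult)
  finally show ?thesis .
qed

text \<open>With H = \<open>hermite k\<close>, the two sides differ by the functional of (q H)' - 2
  x q H, which is 0 by \<open>gauss_pderiv\<close>.\<close>

lemma gauss_mult_hermite_Suc: "gauss (q * hermite (Suc k)) = gauss (pderiv q * hermite k)"
proof -
  have "gauss (pderiv q * hermite k) - gauss (q * hermite (Suc k)) =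
      gauss (pderiv q * hermite k - q * hermite (Suc k))"
    by (simp only: gauss_diff)
  also have "pderiv q * hermite k - q * hermite (Suc k) = pderiv (q * hermite k) - [:0, 2:] * (q * hermite k)"
    by (simp only: pderiv_mult hermite.simps) (simp only: algebra_simps)
  also have "gauss \<dots> = 0"
    by (simp only: gauss_diff gauss_pderiv diff_self)
  finally show ?thesis by simp
qed

text \<open>Moving all \<open>k\<close> derivatives onto \<open>q\<close> leaves the constant
  \<open>coeff q k * fact k\<close>, and the weight has total mass sqrt pi.\<close>

lemma gauss_mult_hermite:
  "degree q \<le> k \<Longrightarrow> gauss (q * hermite k) = coeff q k * fact k * sqrt pi"
proof (induction k arbitrary: q)
  case 0
  then obtain t where "q = [:t:]" by (auto elim: degree_eq_zeroE)
  then show ?case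
    using gaussian_monomial_integral_even[of 0] by (simp add: gauss_def)
next
  case (Suc k)
  have "degree (pderiv q) \<le> k" using Suc.prems by (simp add: degree_pderiv)
  from Suc.IH[OF this] show ?case
    by (simp only: gauss_mult_hermite_Suc) (simp add: coeff_pderiv)
qed

section \<open>The Hermite reproducing kernel\<close>

definition hnorm :: "nat \<Rightarrow> real" where
  "hnorm k = 2 ^ k * fact k * sqrt pi"

lemma hnorm_pos: "hnorm k > 0"
  by (simp add: hnorm_def)

lemma hnorm_Suc: "hnorm (Suc k) = 2 * real (Suc k) * hnorm k"
  by (simp add: hnorm_def)

lemma gauss_hermite_sq: "gauss (hermite k * hermite k) = hnorm k"
  by (simp add: gauss_mult_hermite degree_hermite_le coeff_hermite hnorm_def)

text \<open>The Christoffel-Darboux kernel, kept as a polynomial in one variable with the other one,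
  \<open>x\<close>, as a parameter.\<close>

definition hermite_kernel :: "nat \<Rightarrow> real \<Rightarrow> real poly" where
  "hermite_kernel n x = (\<Sum>k<n. smult (poly (hermite k) x / hnorm k) (hermite k))"

lemma degree_hermite_kernel: "degree (hermite_kernel (Suc n) x) \<le> n"
  unfolding hermite_kernel_def
  by (rule degree_sum_le)
     (auto intro!: order_trans[OF degree_smult_le] order_trans[OF degree_hermite_le])

lemma gauss_mult_hermite_kernel:
  "degree q < n \<Longrightarrow> gauss (q * hermite_kernel n x) = poly q x"
proof (induction n arbitrary: q)
  case (Suc n)
  \<comment> \<open>\<open>hermite n\<close> has leading coefficient \<open>2 ^ n\<close>, so this
    multiple of it removes the top term of \<open>q\<close>.\<close>
  define t where "t = coeff q n / 2 ^ n"
  define p where "p = q - smult t (hermite n)"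
  have q: "q = p + smult t (hermite n)" by (simp add: p_def)
  have dp: "degree p \<le> n"
    unfolding p_def using Suc.prems
    by (intro degree_diff_le order_trans[OF degree_smult_le] degree_hermite_le) simp
  have cp: "coeff p n = 0" by (simp add: p_def t_def coeff_hermite)
  have pk: "gauss (p * hermite_kernel n x) = poly p x"
  \<comment> \<open>The zero polynomial has degree 0, which is not below \<open>n\<close> when
    \<open>n = 0\<close>, so the induction hypothesis does not always cover it.\<close>
  proof (cases "p = 0")
    case False
    then have "degree p < n"
      using dp cp by (metis leading_coeff_0_iff nat_less_le)
    then show ?thesis by (rule Suc.IH)
  qed (simp add: gauss_0)
  have kk: "gauss (hermite n * hermite_kernel n x) = 0"
  proof (cases n)
    case (Suc m)
    have "gauss (hermite_kernel (Suc m) x * hermite (Suc m)) = 0"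
      using degree_hermite_kernel[of m x]
      by (subst gauss_mult_hermite) (auto intro!: coeff_eq_0)
    then show ?thesis by (simp add: Suc mult.commute)
  qed (simp add: hermite_kernel_def gauss_0)
  have ph: "gauss (p * hermite n) = 0"
    using gauss_mult_hermite[OF dp] cp by simp
  have K: "hermite_kernel (Suc n) x =
      hermite_kernel n x + smult (poly (hermite n) x / hnorm n) (hermite n)"
    by (simp add: hermite_kernel_def)
  show ?case
    using hnorm_pos[of n]
    by (simp add: K q distrib_left distrib_right gauss_add gauss_smult pk kk ph gauss_hermite_sq)
qed simp

text \<open>The confluent Christoffel-Darboux formula by induction: 2 \<open>hnorm (Suc n)\<close>
  is 2(n+1) times 2 \<open>hnorm n\<close>, so the new term of the kernel contributes 2 H_{n+1}^2,
  and the three-term recurrence absorbs it.\<close>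

lemma christoffel_darboux_diagonal:
  defines "A \<equiv> \<lambda>k x. poly (hermite k) x"
  shows "2 * hnorm n * poly (hermite_kernel (Suc n) x) x =
    2 * real (Suc n) * (A n x)\<^sup>2 - 2 * x * A (Suc n) x * A n x + (A (Suc n) x)\<^sup>2"
proof (induction n)
  case 0
  show ?case
    by (simp add: A_def hermite_kernel_def hnorm_def power2_eq_square)
next
  case (Suc n)
  have K: "poly (hermite_kernel (Suc (Suc n)) x) x =
      poly (hermite_kernel (Suc n) x) x + (A (Suc n) x)\<^sup>2 / hnorm (Suc n)"
    by (simp add: hermite_kernel_def A_def power2_eq_square del: hermite.simps)
  have "2 * hnorm (Suc n) * poly (hermite_kernel (Suc (Suc n)) x) x =
      2 * real (Suc n) * (2 * hnorm n * poly (hermite_kernel (Suc n) x) x) + 2 * (A (Suc n) x)\<^sup>2"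
    unfolding K using hnorm_pos[of n] hnorm_pos[of "Suc n"]
    by (simp add: distrib_left) (simp add: hnorm_Suc)
  also have "\<dots> = 2 * real (Suc n) * (2 * real (Suc n) * (A n x)\<^sup>2 - 2 * x * A (Suc n) x * A n x + (A (Suc n) x)\<^sup>2)
      + 2 * (A (Suc n) x)\<^sup>2"
    by (simp only: Suc.IH)
  also have "\<dots> = 2 * real (Suc (Suc n)) * (A (Suc n) x)\<^sup>2 - 2 * x * A (Suc (Suc n)) x * A (Suc n) x
      + (A (Suc (Suc n)) x)\<^sup>2"
  proof -
    have "A (Suc (Suc n)) x = 2 * x * A (Suc n) x - 2 * real (Suc n) * A n x"
      unfolding A_def hermite_recurrence by simp
    then show ?thesis
      by (simp only:) (simp add: algebra_simps power2_eq_square)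
  qed
  finally show ?case .
qed

text \<open>A nonnegative integrand with integral 0 vanishes almost everywhere, whereas a nonzero
  polynomial has a finite, hence null, set of roots.\<close>

lemma gauss_square_eq_0_imp:
  assumes "gauss (p * p) = 0"
  shows "p = 0"
proof (rule ccontr)
  assume "p \<noteq> 0"
  have nn: "0 \<le> poly (p * p) x * exp (- x\<^sup>2)" for x by simp
  have "AE x in lborel. poly (p * p) x * exp (- x\<^sup>2) = 0"
    using assms integral_nonneg_eq_0_iff_AE[OF gaussian_poly_integrable[of "p * p"]] nn
    by (simp add: gauss_def)
  then have "AE x in lborel. x \<in> {x. poly p x = 0}" by simp
  moreover have "AE x in lborel. x \<notin> {x. poly p x = 0}"
    using poly_roots_finite[OF \<open>p \<noteq> 0\<close>]
    by (intro AE_not_in finite_imp_null_set_lborel)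
  ultimately have "AE x in (lborel :: real measure). False" by eventually_elim simp
  then show False
    using AE_iff_null[of "lborel :: real measure" "\<lambda>_. False"] by (simp add: null_sets_def)
qed

text \<open>Test with \<open>q = p\<close>. This is how polynomials are identified below: by their
  pairings with all polynomials of bounded degree.\<close>

lemma gauss_orthogonal_imp_0:
  assumes "\<And>q. degree q \<le> n \<Longrightarrow> gauss (q * p) = 0" and "degree p \<le> n"
  shows "p = 0"
  using assms gauss_square_eq_0_imp by blast

section \<open>Interpolation at double nodes\<close>

lemma square_linear_dvd_of_double_root:
  fixes p :: "'a::idom poly"
  assumes "poly p a = 0" "poly (pderiv p) a = 0"
  shows "[:-a, 1:]\<^sup>2 dvd p"
proof -
  from assms(1) obtain r where r: "p = [:-a, 1:] * r"
    by (auto simp: poly_eq_0_iff_dvd)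
  from assms(2) have "poly r a = 0"
    unfolding r pderiv_mult by (simp add: pderiv_pCons)
  then obtain s where "r = [:-a, 1:] * s"
    by (auto simp: poly_eq_0_iff_dvd)
  with r have "p = [:-a, 1:]\<^sup>2 * s" by (simp only: power2_eq_square mult.assoc)
  then show ?thesis by (rule dvdI)
qed

lemma double_root_of_square_linear_dvd:
  fixes p :: "'a::idom poly"
  assumes "[:-a, 1:]\<^sup>2 dvd p"
  shows "poly p a = 0" "poly (pderiv p) a = 0"
proof -
  from assms obtain s where s: "p = [:-a, 1:]\<^sup>2 * s" by (rule dvdE)
  show "poly p a = 0" unfolding s by simp
  show "poly (pderiv p) a = 0" unfolding s pderiv_mult power2_eq_square by simp
qed

text \<open>Nodes are divided out one at a time: the removed square is nonzero at the other nodes,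
  so the quotient keeps its double roots there.\<close>

lemma prod_square_linear_dvd_of_double_roots:
  fixes p :: "'a::idom poly"
  assumes "finite I" "inj_on l I"
    and "\<And>i. i \<in> I \<Longrightarrow> poly p (l i) = 0"
    and "\<And>i. i \<in> I \<Longrightarrow> poly (pderiv p) (l i) = 0"
  shows "(\<Prod>i\<in>I. [:- l i, 1:]\<^sup>2) dvd p"
  using assms
proof (induction I arbitrary: p rule: finite_induct)
  case (insert i I)
  obtain r where r: "p = [:- l i, 1:]\<^sup>2 * r"
    using square_linear_dvd_of_double_root[of p "l i"] insert.prems by (auto elim: dvdE)
  have "poly r (l j) = 0 \<and> poly (pderiv r) (l j) = 0" if j: "j \<in> I" for j
  proof -
    have ne: "l j - l i \<noteq> 0"
      using insert.prems(1) insert.hyps(2) j by (auto simp: inj_on_def)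
    then have 0: "poly r (l j) = 0"
      using insert.prems(2)[of j] j by (simp add: r)
    moreover have "poly (pderiv r) (l j) = 0"
      using insert.prems(3)[of j] j ne 0 by (simp add: r pderiv_mult)
    ultimately show ?thesis by simp
  qed
  then have "(\<Prod>i\<in>I. [:- l i, 1:]\<^sup>2) dvd r"
    using insert.prems(1) by (intro insert.IH) (auto simp: inj_on_def)
  then show ?case
    using insert.hyps by (simp add: r mult_dvd_mono)
qed simp

lemma degree_prod_square_linear:
  fixes l :: "'i \<Rightarrow> 'a::idom"
  assumes "finite I"
  shows "degree (\<Prod>i\<in>I. [:- l i, 1:]\<^sup>2) = 2 * card I"
  using assms by (subst degree_prod_eq_sum_degree) (auto simp: degree_power_eq)

text \<open>Each summand \<open>E i\<close> matches value and slope of \<open>q\<close> at its own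
  node and has double roots at the others. Hence \<open>q\<close> minus the sum is divisible by a
  polynomial of degree \<open>2 * card I\<close>, which exceeds its own degree. The denominators are
  left as squares because the weight will cancel them.\<close>

lemma hermite_interpolation:
  fixes q :: "real poly"
  assumes I: "finite I" "inj_on l I" and q: "degree q < 2 * card I"
  defines "R \<equiv> \<lambda>i. \<Prod>j\<in>I - {i}. [:- l j, 1:]\<^sup>2"
  shows "poly q x = (\<Sum>i\<in>I. poly (R i) x *
    (poly q (l i) * (poly (R i) (l i) + (l i - x) * poly (pderiv (R i)) (l i))
      - poly (pderiv q) (l i) * (l i - x) * poly (R i) (l i)) / (poly (R i) (l i))\<^sup>2)"
proof -
  define m where "m i = poly (R i) (l i)" for i
  \<comment> \<open>\<open>E i\<close> is \<open>R i\<close> times the linear factor q(l_i)/m_i -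
    u_i (x - l_i); \<open>u i\<close> is the slope that makes its derivative at the node equal to
    that of \<open>q\<close>.\<close>
  define u where "u i = (poly q (l i) * poly (pderiv (R i)) (l i) - poly (pderiv q) (l i) * m i) / (m i)\<^sup>2" for i
  define E where "E i = R i * [:poly q (l i) / m i + u i * l i, - u i:]" for i
  have m: "m i \<noteq> 0" if "i \<in> I" for i
    using I that by (auto simp: m_def R_def poly_prod inj_on_def)
  have E0: "poly (E i) (l k) = (if i = k then poly q (l k) else 0)"
    and E1: "poly (pderiv (E i)) (l k) = (if i = k then poly (pderiv q) (l k) else 0)"
    if "i \<in> I" "k \<in> I" for i k
  proof -
    have "poly (E i) (l k) = (if i = k then poly q (l k) else 0) \<and>
      poly (pderiv (E i)) (l k) = (if i = k then poly (pderiv q) (l k) else 0)"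
    proof (cases "i = k")
      case True
      have "m k * u k = (poly q (l k) * poly (pderiv (R k)) (l k) - poly (pderiv q) (l k) * m k) / m k"
        using m[OF that(2)] by (simp add: u_def power2_eq_square)
      then show ?thesis
        using m[OF that(2)] True
        unfolding E_def pderiv_mult
        by (simp add: pderiv_pCons flip: m_def) (simp add: field_simps)
    next
      case False
      have "[:- l k, 1:]\<^sup>2 dvd R i"
        unfolding R_def using I that False by (intro dvd_prodI) auto
      then have "[:- l k, 1:]\<^sup>2 dvd E i" unfolding E_def by (rule dvd_mult2)
      then show ?thesis
        using double_root_of_square_linear_dvd[of "l k" "E i"] False by simp
    qed
    then show "poly (E i) (l k) = (if i = k then poly q (l k) else 0)"
      "poly (pderiv (E i)) (l k) = (if i = k then poly (pderiv q) (l k) else 0)" by auto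
  qed
  define D where "D = q - (\<Sum>i\<in>I. E i)"
  have "(\<Prod>i\<in>I. [:- l i, 1:]\<^sup>2) dvd D"
    using I by (intro prod_square_linear_dvd_of_double_roots)
      (simp_all add: D_def poly_sum E0 E1 pderiv_diff pderiv_sum sum.delta)
  moreover have "degree D < 2 * card I"
  proof -
    have "degree (E i) \<le> 2 * card I - 1" if "i \<in> I" for i
    proof -
      have "degree (R i) = 2 * (card I - 1)"
        unfolding R_def using I that by (simp add: degree_prod_square_linear)
      moreover have "card I > 0" using I that by (auto simp: card_gt_0_iff)
      moreover have "degree [:poly q (l i) / m i + u i * l i, - u i:] \<le> 1" by simp
      ultimately show ?thesis
        unfolding E_def using degree_mult_le[of "R i" "[:poly q (l i) / m i + u i * l i, - u i:]"]
        by linarith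
    qed
    then have "degree (\<Sum>i\<in>I. E i) \<le> 2 * card I - 1"
      using I by (intro degree_sum_le) auto
    then show ?thesis
      unfolding D_def using q degree_diff_le[of q "2 * card I - 1" "\<Sum>i\<in>I. E i"] by linarith
  qed
  ultimately have "D = 0"
    using I dvd_imp_degree_le[of "\<Prod>i\<in>I. [:- l i, 1:]\<^sup>2" D] by (auto simp: degree_prod_square_linear)
  then have "poly q x = (\<Sum>i\<in>I. poly (E i) x)"
    by (simp add: D_def flip: poly_sum)
  also have "\<dots> = (\<Sum>i\<in>I. poly (R i) x *
    (poly q (l i) * (poly (R i) (l i) + (l i - x) * poly (pderiv (R i)) (l i))
      - poly (pderiv q) (l i) * (l i - x) * poly (R i) (l i)) / (poly (R i) (l i))\<^sup>2)"
  proof (rule sum.cong[OF refl])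
    fix i assume i: "i \<in> I"
    show "poly (E i) x = poly (R i) x *
    (poly q (l i) * (poly (R i) (l i) + (l i - x) * poly (pderiv (R i)) (l i))
      - poly (pderiv q) (l i) * (l i - x) * poly (R i) (l i)) / (poly (R i) (l i))\<^sup>2"
      using m[OF i] unfolding E_def u_def m_def
      by (simp add: field_simps power2_eq_square)
  qed
  finally show ?thesis .
qed

section \<open>Exchange symmetry of the weight and weighted interpolation\<close>

lemma prod_pairs_sq_eq_prod_ordered:
  fixes g :: "nat \<Rightarrow> nat \<Rightarrow> 'a::comm_monoid_mult"
  assumes "\<And>i j. g i j = g j i"
  shows "(\<Prod>k<N. \<Prod>j<k. (g k j)\<^sup>2) = (\<Prod>k<N. \<Prod>j\<in>{..<N} - {k}. g k j)"
proof (induction N)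
  case (Suc N)
  have "(\<Prod>j\<in>{..<Suc N} - {k}. g k j) = g k N * (\<Prod>j\<in>{..<N} - {k}. g k j)" if "k < N" for k
  proof -
    have "{..<Suc N} - {k} = insert N ({..<N} - {k})" using that by auto
    then show ?thesis by simp
  qed
  then have "(\<Prod>k<N. \<Prod>j\<in>{..<Suc N} - {k}. g k j) =
      (\<Prod>k<N. g k N) * (\<Prod>k<N. \<Prod>j\<in>{..<N} - {k}. g k j)"
    by (simp add: prod.distrib)
  moreover have "{..<Suc N} - {N} = {..<N}" by auto
  moreover have "(\<Prod>k<N. g k N) = (\<Prod>k<N. g N k)" using assms by (intro prod.cong) auto
  ultimately show ?case
    using Suc by (simp add: prod.distrib power2_eq_square ac_simps)
qed simp

text \<open>Passing to ordered pairs, each difference squared, removes the order of the indices, so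
  a permutation only reindexes the factors.\<close>

lemma gse_weight_symmetric:
  assumes p: "bij_betw p {..<N} {..<N}"
  shows "gse_weight N (l \<circ> p) = gse_weight N l"
proof -
  have sym: "(\<Prod>k<N. \<Prod>j<k. \<bar>l k - l j\<bar> ^ 4) = (\<Prod>k<N. \<Prod>j\<in>{..<N} - {k}. \<bar>l k - l j\<bar>\<^sup>2)" for l :: "nat \<Rightarrow> real"
    using prod_pairs_sq_eq_prod_ordered[of "\<lambda>k j. \<bar>l k - l j\<bar>\<^sup>2" N]
    by (simp add: abs_minus_commute flip: power_mult)
  have "(\<Prod>k<N. \<Prod>j\<in>{..<N} - {k}. \<bar>l (p k) - l (p j)\<bar>\<^sup>2) =
      (\<Prod>k<N. \<Prod>j\<in>{..<N} - {p k}. \<bar>l (p k) - l j\<bar>\<^sup>2)"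
  proof (rule prod.cong[OF refl])
    fix k assume k: "k \<in> {..<N}"
    have "bij_betw p ({..<N} - {k}) ({..<N} - {p k})"
      using bij_betw_DiffI[OF p, of "{k}" "{p k}"] k p by (auto simp: bij_betw_def)
    then show "(\<Prod>j\<in>{..<N} - {k}. \<bar>l (p k) - l (p j)\<bar>\<^sup>2) = (\<Prod>j\<in>{..<N} - {p k}. \<bar>l (p k) - l j\<bar>\<^sup>2)"
      by (rule prod.reindex_bij_betw)
  qed
  also have "\<dots> = (\<Prod>k<N. \<Prod>j\<in>{..<N} - {k}. \<bar>l k - l j\<bar>\<^sup>2)"
    by (rule prod.reindex_bij_betw[OF p])
  finally have "(\<Prod>k<N. \<Prod>j\<in>{..<N} - {k}. \<bar>l (p k) - l (p j)\<bar>\<^sup>2) =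
    (\<Prod>k<N. \<Prod>j\<in>{..<N} - {k}. \<bar>l k - l j\<bar>\<^sup>2)" .
  moreover have "(\<Prod>j<N. exp (- (l (p j))\<^sup>2)) = (\<Prod>j<N. exp (- (l j)\<^sup>2))"
    by (rule prod.reindex_bij_betw[OF p])
  ultimately show ?thesis
    by (simp only: gse_weight_def sym sym[of "\<lambda>k. l (p k)"] comp_def)
qed

definition sqpoly :: "nat \<Rightarrow> (nat \<Rightarrow> real) \<Rightarrow> real poly" where
  "sqpoly n l = (\<Prod>j<n. [:- l j, 1:]\<^sup>2)"

lemma degree_sqpoly: "degree (sqpoly n l) = 2 * n"
  unfolding sqpoly_def using degree_prod_square_linear[of "{..<n}" l] by simp

text \<open>The exponent 4 is what fits double nodes: the interaction of the last eigenvalue with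
  the others is exactly the squared denominator of \<open>hermite_interpolation\<close>.\<close>

lemma gse_weight_Suc:
  "gse_weight (Suc n) l = gse_weight n l * exp (- (l n)\<^sup>2) * (poly (sqpoly n l) (l n))\<^sup>2"
proof -
  have "(\<Prod>j<n. \<bar>l n - l j\<bar> ^ 4) = (poly (sqpoly n l) (l n))\<^sup>2"
    by (simp add: sqpoly_def poly_prod flip: prod_power_distrib power_mult)
  then show ?thesis
    by (simp add: gse_weight_def)
qed

text \<open>The kernel S(x,y) before averaging over \<open>l\<close>, as a polynomial in y with
  \<open>x\<close> as a parameter.\<close>

definition skew_kernel :: "nat \<Rightarrow> (nat \<Rightarrow> real) \<Rightarrow> real \<Rightarrow> real poly" where
  "skew_kernel n l x = [:- x, 1:] * smult (poly (sqpoly n l) x) (sqpoly n l)"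

text \<open>The summand of the weighted interpolation formula for the node in last place; as a
  function of \<open>l n\<close> it is an integrand of the skew form.\<close>

definition interpolation_term :: "nat \<Rightarrow> real poly \<Rightarrow> real \<Rightarrow> (nat \<Rightarrow> real) \<Rightarrow> real" where
  "interpolation_term n q x l = gse_weight n l * exp (- (l n)\<^sup>2) *
    (poly q (l n) * poly (pderiv (skew_kernel n l x)) (l n)
      - poly (pderiv q) (l n) * poly (skew_kernel n l x) (l n))"

lemma bij_betw_transpose_last:
  assumes "i \<le> n"
  shows "bij_betw (Transposition.transpose i n) {..<n} ({..<Suc n} - {i})"
  by (rule bij_betw_byWitness[where f' = "Transposition.transpose i n"])
    (use assms in \<open>auto simp: Transposition.transpose_def\<close>)

lemma bij_betw_transpose_all:
  assumes "i \<le> n"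
  shows "bij_betw (Transposition.transpose i n) {..<Suc n} {..<Suc n}"
  by (rule bij_betw_byWitness[where f' = "Transposition.transpose i n"])
    (use assms in \<open>auto simp: Transposition.transpose_def\<close>)

lemma sqpoly_transpose:
  assumes "i \<le> n"
  shows "sqpoly n (l \<circ> Transposition.transpose i n) = (\<Prod>j\<in>{..<Suc n} - {i}. [:- l j, 1:]\<^sup>2)"
  unfolding sqpoly_def comp_def by (rule prod.reindex_bij_betw[OF bij_betw_transpose_last[OF assms]])

text \<open>Covers coinciding eigenvalues, where interpolation breaks down: if \<open>l n\<close>
  equals an earlier node, the kernel has a double root there, so its value and its derivative both
  vanish.\<close>

lemma interpolation_term_eq_0:
  assumes "gse_weight (Suc n) l = 0"
  shows "interpolation_term n q x l = 0"
proof (cases "gse_weight n l = 0")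
  case False
  with assms have "poly (sqpoly n l) (l n) = 0"
    by (simp add: gse_weight_Suc)
  then obtain j where j: "j < n" "l j = l n"
    by (auto simp: sqpoly_def poly_prod)
  then have "[:- l n, 1:]\<^sup>2 dvd sqpoly n l"
    unfolding sqpoly_def using dvd_prodI[of "{..<n}" j "\<lambda>j. [:- l j, 1:]\<^sup>2"] by auto
  then have "[:- l n, 1:]\<^sup>2 dvd skew_kernel n l x"
    unfolding skew_kernel_def by (intro dvd_mult dvd_smult)
  from double_root_of_square_linear_dvd[OF this] show ?thesis
    by (simp add: interpolation_term_def)
qed (simp add: interpolation_term_def)

text \<open>The weight contains the squared denominator of every interpolation summand, so
  multiplying by it clears them all. Transposing \<open>i\<close> with \<open>n\<close> puts node
  \<open>i\<close> last, which makes all summands instances of one function.\<close>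

lemma weighted_interpolation:
  assumes q: "degree q \<le> 2 * n + 1"
  shows "poly q x * gse_weight (Suc n) l =
    (\<Sum>i<Suc n. interpolation_term n q x (l \<circ> Transposition.transpose i n))"
proof (cases "gse_weight (Suc n) l = 0")
  case True
  have "interpolation_term n q x (l \<circ> Transposition.transpose i n) = 0" if "i < Suc n" for i
    using that True by (intro interpolation_term_eq_0)
      (simp add: gse_weight_symmetric bij_betw_transpose_all)
  then show ?thesis by (simp add: True del: sum.lessThan_Suc)
next
  case False
  define R where "R i = (\<Prod>j\<in>{..<Suc n} - {i}. [:- l j, 1:]\<^sup>2)" for i
  have inj: "inj_on l {..<Suc n}"
  proof (rule inj_onI, rule ccontr)
    fix i j assume ij: "i \<in> {..<Suc n}" "j \<in> {..<Suc n}" "l i = l j" "i \<noteq> j"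
    have "(\<Prod>k<Suc n. \<Prod>j<k. \<bar>l k - l j\<bar> ^ 4) = 0"
    proof (cases "j < i")
      case True
      then show ?thesis using ij
        by (intro prod_zero bexI[of _ i] bexI[of _ j]) auto
    next
      case False
      then show ?thesis using ij
        by (intro prod_zero bexI[of _ i] bexI[of _ j]) auto
    qed
    with False show "False" by (simp add: gse_weight_def)
  qed
  have "interpolation_term n q x (l \<circ> Transposition.transpose i n) = gse_weight (Suc n) l *
    (poly (R i) x * (poly q (l i) * (poly (R i) (l i) + (l i - x) * poly (pderiv (R i)) (l i))
      - poly (pderiv q) (l i) * (l i - x) * poly (R i) (l i)) / (poly (R i) (l i))\<^sup>2)"
    if i: "i < Suc n" for i
  proof -
    have W: "gse_weight (Suc n) l =
        gse_weight n (l \<circ> Transposition.transpose i n) * exp (- (l i)\<^sup>2) * (poly (R i) (l i))\<^sup>2"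
      using gse_weight_Suc[of n "l \<circ> Transposition.transpose i n"] i
        gse_weight_symmetric[of "Transposition.transpose i n" "Suc n" l]
      by (simp add: sqpoly_transpose bij_betw_transpose_all R_def)
    have "poly (R i) (l i) \<noteq> 0"
      using W False by auto
    then show ?thesis
      using i unfolding W
      by (simp add: interpolation_term_def skew_kernel_def sqpoly_transpose pderiv_mult pderiv_smult
          pderiv_pCons del: mult_pCons_left flip: R_def)
         (simp add: field_simps)
  qed
  then have "(\<Sum>i<Suc n. interpolation_term n q x (l \<circ> Transposition.transpose i n)) =
     gse_weight (Suc n) l * poly q x"
    using hermite_interpolation[OF _ inj, of q x] q
    by (simp add: R_def sum_distrib_left del: sum.lessThan_Suc)
  then show ?thesis by simp
qed

section \<open>Integration over the eigenvalues\<close>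

abbreviation lborel_power :: "nat \<Rightarrow> (nat \<Rightarrow> real) measure" where
  "lborel_power n \<equiv> (\<Pi>\<^sub>M j\<in>{..<n}. lborel)"

interpretation lborel_product: product_sigma_finite "\<lambda>_::nat. lborel :: real measure"
  by standard

text \<open>A growth class containing constants and coordinates and closed under sums and products;
  it stands in for multivariate polynomials in the integrability proofs.\<close>

definition poly_bounded :: "nat \<Rightarrow> ((nat \<Rightarrow> real) \<Rightarrow> real) \<Rightarrow> bool" where
  "poly_bounded n f \<longleftrightarrow> f \<in> borel_measurable (lborel_power n) \<and>
    (\<exists>C m. \<forall>l. \<bar>f l\<bar> \<le> C * (\<Prod>j<n. 1 + (l j)\<^sup>2) ^ m)"

lemma poly_bounded_const: "poly_bounded n (\<lambda>_. t)"
  unfolding poly_bounded_def by (intro conjI exI[of _ "\<bar>t\<bar>"] exI[of _ 0]) simp_all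

lemma poly_bounded_coordinate:
  assumes "i < n"
  shows "poly_bounded n (\<lambda>l. l i)"
proof -
  have "\<bar>l i\<bar> \<le> 1 * (\<Prod>j<n. 1 + (l j)\<^sup>2) ^ 1" for l :: "nat \<Rightarrow> real"
  proof -
    \<comment> \<open>Expanding gives \<bar>t\<bar> \<le> t^2 + 1/4 for t =
      \<open>l i\<close>.\<close>
    have "0 \<le> (\<bar>l i\<bar> - 1/2)\<^sup>2" by simp
    then have "\<bar>l i\<bar> \<le> 1 + (l i)\<^sup>2" by (simp add: power2_diff power_divide)
    also have "\<dots> = (\<Prod>j\<in>{i}. 1 + (l j)\<^sup>2)" by simp
    also have "\<dots> \<le> (\<Prod>j<n. 1 + (l j)\<^sup>2)"
      using assms by (intro prod_mono2) auto
    finally show ?thesis by simp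
  qed
  then show ?thesis
    unfolding poly_bounded_def using assms
    by (intro conjI exI[of _ "1::real"] exI[of _ "1::nat"]) simp_all
qed

lemma poly_bounded_add:
  assumes "poly_bounded n f" "poly_bounded n g"
  shows "poly_bounded n (\<lambda>l. f l + g l)"
proof -
  let ?P = "\<lambda>l. \<Prod>j<n. 1 + (l j)\<^sup>2"
  obtain C m C' m' where
    f: "\<And>l. \<bar>f l\<bar> \<le> C * ?P l ^ m" and g: "\<And>l. \<bar>g l\<bar> \<le> C' * ?P l ^ m'"
    using assms unfolding poly_bounded_def by blast
  have P: "1 \<le> ?P l" for l :: "nat \<Rightarrow> real" by (rule prod_ge_1) simp
  \<comment> \<open>Evaluating the bounds at the origin shows that the constants are nonnegative, so
    the exponents may be raised.\<close>
  have C: "0 \<le> C" "0 \<le> C'"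
    using order_trans[OF abs_ge_zero f[of "\<lambda>_. 0"]] order_trans[OF abs_ge_zero g[of "\<lambda>_. 0"]] by simp_all
  have "\<bar>f l + g l\<bar> \<le> (C + C') * ?P l ^ (m + m')" for l
  proof -
    have "C * ?P l ^ m \<le> C * ?P l ^ (m + m')" "C' * ?P l ^ m' \<le> C' * ?P l ^ (m + m')"
      using P[of l] C by (auto intro!: mult_left_mono power_increasing)
    then show ?thesis
      using f[of l] g[of l] by (simp add: distrib_right)
  qed
  then show ?thesis
    using assms unfolding poly_bounded_def by auto
qed

lemma poly_bounded_mult:
  assumes "poly_bounded n f" "poly_bounded n g"
  shows "poly_bounded n (\<lambda>l. f l * g l)"
proof -
  let ?P = "\<lambda>l. \<Prod>j<n. 1 + (l j)\<^sup>2"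
  obtain C m C' m' where
    f: "\<And>l. \<bar>f l\<bar> \<le> C * ?P l ^ m" and g: "\<And>l. \<bar>g l\<bar> \<le> C' * ?P l ^ m'"
    using assms unfolding poly_bounded_def by blast
  have "\<bar>f l * g l\<bar> \<le> (C * C') * ?P l ^ (m + m')" for l
  proof -
    have "\<bar>f l * g l\<bar> \<le> (C * ?P l ^ m) * (C' * ?P l ^ m')"
      unfolding abs_mult by (intro mult_mono f g order_trans[OF abs_ge_zero f]) simp
    then show ?thesis by (simp add: power_add ac_simps)
  qed
  then show ?thesis
    using assms unfolding poly_bounded_def by auto
qed

lemma poly_bounded_sum:
  "(\<And>i. i \<in> A \<Longrightarrow> poly_bounded n (f i)) \<Longrightarrow> poly_bounded n (\<lambda>l. \<Sum>i\<in>A. f i l)"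
  by (induction A rule: infinite_finite_induct) (auto intro: poly_bounded_const poly_bounded_add)

lemma poly_bounded_prod:
  "(\<And>i. i \<in> A \<Longrightarrow> poly_bounded n (f i)) \<Longrightarrow> poly_bounded n (\<lambda>l. \<Prod>i\<in>A. f i l)"
  by (induction A rule: infinite_finite_induct) (auto intro: poly_bounded_const poly_bounded_mult)

lemma poly_bounded_power: "poly_bounded n f \<Longrightarrow> poly_bounded n (\<lambda>l. f l ^ k)"
  by (induction k) (auto intro: poly_bounded_const poly_bounded_mult)

lemma poly_bounded_gaussian_integrable:
  assumes "poly_bounded n f"
  shows "integrable (lborel_power n) (\<lambda>l. f l * (\<Prod>j<n. exp (- (l j)\<^sup>2)))"
proof -
  obtain C m where f: "\<And>l. \<bar>f l\<bar> \<le> C * (\<Prod>j<n. 1 + (l j)\<^sup>2) ^ m"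
    and [measurable]: "f \<in> borel_measurable (lborel_power n)"
    using assms unfolding poly_bounded_def by blast
  have E: "(\<lambda>l. \<Prod>j<n. exp (- (l j)\<^sup>2)) \<in> borel_measurable (lborel_power n)"
    by (intro borel_measurable_prod) measurable
  have "integrable lborel (\<lambda>y::real. (1 + y\<^sup>2) ^ m * exp (- y\<^sup>2))"
    using gaussian_poly_integrable[of "[:1, 0, 1:] ^ m"] by (simp add: power2_eq_square)
  then have "integrable (lborel_power n) (\<lambda>l. C * (\<Prod>j<n. (1 + (l j)\<^sup>2) ^ m * exp (- (l j)\<^sup>2)))"
    by (intro integrable_mult_right lborel_product.product_integrable_prod) auto
  then show ?thesis
  proof (rule Bochner_Integration.integrable_bound)
    show "(\<lambda>l. f l * (\<Prod>j<n. exp (- (l j)\<^sup>2))) \<in> borel_measurable (lborel_power n)"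
      using E by measurable
    show "AE l in lborel_power n. norm (f l * (\<Prod>j<n. exp (- (l j)\<^sup>2)))
        \<le> norm (C * (\<Prod>j<n. (1 + (l j)\<^sup>2) ^ m * exp (- (l j)\<^sup>2)))"
    proof (rule AE_I2)
      fix l
      have "norm (f l * (\<Prod>j<n. exp (- (l j)\<^sup>2))) = \<bar>f l\<bar> * (\<Prod>j<n. exp (- (l j)\<^sup>2))"
        by (simp add: abs_mult abs_prod)
      also have "\<dots> \<le> C * (\<Prod>j<n. 1 + (l j)\<^sup>2) ^ m * (\<Prod>j<n. exp (- (l j)\<^sup>2))"
        by (intro mult_right_mono f prod_nonneg) simp
      also have "\<dots> = C * (\<Prod>j<n. (1 + (l j)\<^sup>2) ^ m * exp (- (l j)\<^sup>2))"
        by (simp add: prod.distrib prod_power_distrib)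
      finally show "norm (f l * (\<Prod>j<n. exp (- (l j)\<^sup>2)))
        \<le> norm (C * (\<Prod>j<n. (1 + (l j)\<^sup>2) ^ m * exp (- (l j)\<^sup>2)))"
        by simp
    qed
  qed
qed

lemma gse_weight_integrable:
  assumes "poly_bounded n f"
  shows "integrable (lborel_power n) (\<lambda>l. f l * gse_weight n l)"
proof -
  \<comment> \<open>The absolute values disappear under the even power, and the differences are
    spelled as sums to match the closure rules.\<close>
  have "poly_bounded n (\<lambda>l. f l * (\<Prod>k<n. \<Prod>j<k. (l k + (- 1) * l j) ^ 4))"
    by (intro poly_bounded_mult assms poly_bounded_prod poly_bounded_power poly_bounded_add
        poly_bounded_coordinate poly_bounded_const) auto
  from poly_bounded_gaussian_integrable[OF this] show ?thesis
    by (simp add: gse_weight_def ac_simps)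
qed

lemma gse_weight_measurable: "gse_weight n \<in> borel_measurable (lborel_power n)"
  using borel_measurable_integrable[OF gse_weight_integrable[OF poly_bounded_const[of _ 1]]] by simp

lemma poly_bounded_coeff_sqpoly: "poly_bounded n (\<lambda>l. coeff (sqpoly n l) k)"
proof -
  define ok where "ok p \<longleftrightarrow> (\<forall>k. poly_bounded n (\<lambda>l. coeff (p l) k))" for p :: "(nat \<Rightarrow> real) \<Rightarrow> real poly"
  have mult: "ok (\<lambda>l. p l * q l)" if "ok p" "ok q" for p q
    using that unfolding ok_def coeff_mult by (auto intro!: poly_bounded_sum poly_bounded_mult)
  have lin: "ok (\<lambda>l. [:- l j, 1:])" if "j < n" for j
    unfolding ok_def
  proof
    fix k
    show "poly_bounded n (\<lambda>l. coeff [:- l j, 1:] k)"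
      using poly_bounded_mult[OF poly_bounded_const[of n "-1"] poly_bounded_coordinate[OF that]]
      by (cases k) (auto simp: coeff_pCons poly_bounded_const split: nat.split)
  qed
  \<comment> \<open>The induction is on the number \<open>m\<close> of factors with \<open>n\<close>
    fixed, since \<open>ok\<close> refers to the growth class in \<open>n\<close>
    coordinates.\<close>
  have "ok (\<lambda>l. \<Prod>j<m. [:- l j, 1:]\<^sup>2)" if "m \<le> n" for m
    using that
  proof (induction m)
    case 0
    show ?case by (simp add: ok_def poly_bounded_const)
  next
    case (Suc m)
    then show ?case
      unfolding power2_eq_square by (auto intro!: mult lin simp del: mult_pCons_left mult_pCons_right)
  qed
  then show ?thesis
    by (simp add: sqpoly_def ok_def)
qed

lemma integral_separate_last:
  fixes c :: "(nat \<Rightarrow> real) \<Rightarrow> real" and g :: "real \<Rightarrow> real"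
  assumes c: "integrable (lborel_power n) c" and c_local: "\<And>l y. c (l(n := y)) = c l"
    and g: "integrable lborel g"
  shows "integrable (lborel_power (Suc n)) (\<lambda>l. c l * g (l n))"
    and "(\<integral>l. c l * g (l n) \<partial>lborel_power (Suc n)) =
      (\<integral>l. c l \<partial>lborel_power n) * (\<integral>y. g y \<partial>lborel)"
proof -
  have S: "{..<Suc n} = insert n {..<n}" by auto
  have [measurable]: "c \<in> borel_measurable (lborel_power n)" "g \<in> borel_measurable lborel"
    using c g by auto
  \<comment> \<open>Restriction resets only coordinate \<open>n\<close>, which \<open>c\<close>
    ignores; so \<open>c\<close> is measurable on the larger product as well.\<close>
  have "c l = c (restrict l {..<n})" if "l \<in> space (lborel_power (Suc n))" for l
  proof -
    have "restrict l {..<n} = l(n := undefined)"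
      using that by (auto simp: space_PiM restrict_def PiE_def extensional_def fun_eq_iff)
    then show ?thesis by (simp add: c_local)
  qed
  moreover have "(\<lambda>l. c (restrict l {..<n})) \<in> borel_measurable (lborel_power (Suc n))"
    by (rule measurable_compose[OF measurable_restrict_subset[of "{..<n}" "{..<Suc n}"]]) auto
  ultimately have c': "c \<in> borel_measurable (lborel_power (Suc n))"
    by (subst measurable_cong) auto
  have g': "(\<lambda>l. g (l n)) \<in> borel_measurable (lborel_power (Suc n))"
    by (rule measurable_compose[OF measurable_component_singleton]) auto
  note m [measurable] = borel_measurable_times[OF c' g']
  have "(\<integral>\<^sup>+l. ennreal (norm (c l * g (l n))) \<partial>lborel_power (Suc n)) =
      (\<integral>\<^sup>+l. (\<integral>\<^sup>+y. ennreal (norm (c (l(n := y)) * g y)) \<partial>lborel) \<partial>lborel_power n)"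
    unfolding S using m
    by (subst lborel_product.product_nn_integral_insert) (auto simp: S)
  also have "\<dots> = (\<integral>\<^sup>+l. ennreal (norm (c l)) * (\<integral>\<^sup>+y. ennreal (norm (g y)) \<partial>lborel) \<partial>lborel_power n)"
    by (simp add: c_local abs_mult ennreal_mult nn_integral_cmult)
  also have "\<dots> = (\<integral>\<^sup>+l. ennreal (norm (c l)) \<partial>lborel_power n) * (\<integral>\<^sup>+y. ennreal (norm (g y)) \<partial>lborel)"
    by (rule nn_integral_multc) measurable
  also have "\<dots> < \<infinity>"
    using c g by (auto simp: integrable_iff_bounded ennreal_mult_less_top)
  finally show i: "integrable (lborel_power (Suc n)) (\<lambda>l. c l * g (l n))"
    using m by (simp add: integrable_iff_bounded)
  show "(\<integral>l. c l * g (l n) \<partial>lborel_power (Suc n)) =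
      (\<integral>l. c l \<partial>lborel_power n) * (\<integral>y. g y \<partial>lborel)"
    using i unfolding S
    by (subst lborel_product.product_integral_insert) (auto simp: c_local)
qed

text \<open>It suffices to compare boxes: the preimage of a box is the box with permuted sides,
  which has the same volume.\<close>

lemma lborel_power_transpose:
  assumes "i \<le> n"
  defines "\<tau> \<equiv> \<lambda>l :: nat \<Rightarrow> real. l \<circ> Transposition.transpose i n"
  shows "\<tau> \<in> measurable (lborel_power (Suc n)) (lborel_power (Suc n))"
    and "distr (lborel_power (Suc n)) (lborel_power (Suc n)) \<tau> = lborel_power (Suc n)"
proof -
  let ?t = "Transposition.transpose i n"
  have t: "?t j \<in> {..<Suc n}" if "j \<in> {..<Suc n}" for j
    using bij_betw_transpose_all[OF assms(1)] that by (auto simp: bij_betw_def)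
  have t': "?t j = j" if "j \<notin> {..<Suc n}" for j
    using that assms(1) by (auto simp: Transposition.transpose_def)
  show m: "\<tau> \<in> measurable (lborel_power (Suc n)) (lborel_power (Suc n))"
    unfolding \<tau>_def comp_def
    by (rule measurable_PiM_single')
       (use t t' in \<open>auto simp: space_PiM PiE_def extensional_def intro!: measurable_component_singleton\<close>)
  show "distr (lborel_power (Suc n)) (lborel_power (Suc n)) \<tau> = lborel_power (Suc n)"
  proof (rule lborel_product.PiM_eqI)
    fix A :: "nat \<Rightarrow> real set"
    assume A: "\<And>j. j \<in> {..<Suc n} \<Longrightarrow> A j \<in> sets lborel"
    have "\<tau> -` Pi\<^sub>E {..<Suc n} A \<inter> space (lborel_power (Suc n)) = Pi\<^sub>E {..<Suc n} (\<lambda>j. A (?t j))"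
    proof (intro set_eqI iffI)
      fix l assume l: "l \<in> \<tau> -` Pi\<^sub>E {..<Suc n} A \<inter> space (lborel_power (Suc n))"
      have "l j \<in> A (?t j)" if "j \<in> {..<Suc n}" for j
      proof -
        have "\<tau> l (?t j) \<in> A (?t j)" using l t[OF that] by (auto simp: PiE_def Pi_def)
        then show ?thesis by (simp add: \<tau>_def)
      qed
      with l show "l \<in> Pi\<^sub>E {..<Suc n} (\<lambda>j. A (?t j))"
        by (auto simp: space_PiM PiE_def)
    next
      fix l assume l: "l \<in> Pi\<^sub>E {..<Suc n} (\<lambda>j. A (?t j))"
      have "\<tau> l j \<in> A j" if "j \<in> {..<Suc n}" for j
        using PiE_mem[OF l t[OF that]] by (simp add: \<tau>_def)
      moreover have "\<tau> l j = undefined" if "j \<notin> {..<Suc n}" for j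
        using l that t' by (simp add: \<tau>_def PiE_def extensional_def)
      ultimately show "l \<in> \<tau> -` Pi\<^sub>E {..<Suc n} A \<inter> space (lborel_power (Suc n))"
        using l by (auto simp: space_PiM PiE_def extensional_def)
    qed
    then have "emeasure (distr (lborel_power (Suc n)) (lborel_power (Suc n)) \<tau>) (Pi\<^sub>E {..<Suc n} A) =
        emeasure (lborel_power (Suc n)) (Pi\<^sub>E {..<Suc n} (\<lambda>j. A (?t j)))"
      using A m by (subst emeasure_distr) (auto intro!: sets_PiM_I_finite)
    also have "\<dots> = (\<Prod>j\<in>{..<Suc n}. emeasure lborel (A (?t j)))"
      using A t by (intro lborel_product.emeasure_PiM) auto
    also have "\<dots> = (\<Prod>j\<in>{..<Suc n}. emeasure lborel (A j))"
      by (rule prod.reindex_bij_betw[OF bij_betw_transpose_all[OF assms(1)]])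
    finally show "emeasure (distr (lborel_power (Suc n)) (lborel_power (Suc n)) \<tau>) (Pi\<^sub>E {..<Suc n} A) =
      (\<Prod>j\<in>{..<Suc n}. emeasure lborel (A j))" .
  qed auto
qed

lemma integral_transpose:
  fixes F :: "(nat \<Rightarrow> real) \<Rightarrow> real"
  assumes i: "i \<le> n" and F: "integrable (lborel_power (Suc n)) F"
  shows "integrable (lborel_power (Suc n)) (\<lambda>l. F (l \<circ> Transposition.transpose i n))"
    and "(\<integral>l. F (l \<circ> Transposition.transpose i n) \<partial>lborel_power (Suc n)) =
      (\<integral>l. F l \<partial>lborel_power (Suc n))"
proof -
  note m = lborel_power_transpose(1)[OF i] and d = lborel_power_transpose(2)[OF i]
  show "integrable (lborel_power (Suc n)) (\<lambda>l. F (l \<circ> Transposition.transpose i n))"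
    by (rule integrable_distr[OF m]) (simp only: d F)
  show "(\<integral>l. F (l \<circ> Transposition.transpose i n) \<partial>lborel_power (Suc n)) =
      (\<integral>l. F l \<partial>lborel_power (Suc n))"
    using integral_distr[OF m borel_measurable_integrable[OF F]] by (simp only: d)
qed

lemma gse_weight_nonneg: "gse_weight n l \<ge> 0"
  by (simp add: gse_weight_def prod_nonneg)

lemma gse_partition_function_pos: "gse_partition_function n > 0"
proof (rule ccontr)
  assume "\<not> gse_partition_function n > 0"
  moreover have "gse_partition_function n \<ge> 0"
    unfolding gse_partition_function_def by (simp add: gse_weight_nonneg)
  ultimately have "(\<integral>l. gse_weight n l \<partial>lborel_power n) = 0"
    by (simp add: gse_partition_function_def)
  moreover have "integrable (lborel_power n) (gse_weight n)"
    using gse_weight_integrable[OF poly_bounded_const[of n 1]] by simp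
  ultimately have AE0: "AE l in lborel_power n. gse_weight n l = 0"
    by (subst (asm) integral_nonneg_eq_0_iff_AE) (auto simp: gse_weight_nonneg)
  \<comment> \<open>Separated unit intervals: on this box of volume 1 the coordinates are strictly
    increasing, so the weight is positive.\<close>
  let ?B = "Pi\<^sub>E {..<n} (\<lambda>j. {real (2 * j)..real (2 * j + 1)})"
  have "gse_weight n l > 0" if l: "l \<in> ?B" for l
  proof -
    have "l j < l k" if "j < k" "k < n" for j k
    proof -
      have "l j \<le> real (2 * j + 1)" "real (2 * k) \<le> l k"
        using l that by (auto simp: PiE_iff)
      moreover have "real (2 * j + 1) < real (2 * k)"
        using that(1) by (subst of_nat_less_iff) simp
      ultimately show ?thesis by linarith
    qed
    then have "\<bar>l k - l j\<bar> > 0" if "j < k" "k < n" for j k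
      using that by fastforce
    then show ?thesis
      unfolding gse_weight_def by (intro mult_pos_pos prod_pos) auto
  qed
  then have "AE l in lborel_power n. l \<notin> ?B"
    by (intro eventually_mono[OF AE0]) (metis less_irrefl)
  moreover have B: "?B \<in> sets (lborel_power n)"
    by (intro sets_PiM_I_finite) auto
  ultimately have "emeasure (lborel_power n) ?B = 0"
    using AE_iff_measurable[OF B, of "\<lambda>l. l \<notin> ?B"] sets.sets_into_space[OF B] by auto
  moreover have "emeasure (lborel_power n) ?B = (\<Prod>j<n. emeasure lborel {real (2 * j)..real (2 * j + 1)})"
    by (intro lborel_product.emeasure_PiM) auto
  moreover have "\<dots> = 1"
    by (intro prod.neutral) simp
  ultimately show False by simp
qed

section \<open>The skew form and the reproducing kernel\<close>

definition skew :: "real poly \<Rightarrow> real poly \<Rightarrow> real" where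
  "skew q p = gauss (q * pderiv p - pderiv q * p)"

lemma skew_add: "skew q (p + p') = skew q p + skew q p'"
  by (simp add: skew_def pderiv_add algebra_simps flip: gauss_add)

lemma skew_smult: "skew q (smult t p) = t * skew q p"
  by (simp add: skew_def pderiv_smult gauss_diff gauss_smult algebra_simps)

lemma skew_diff: "skew q (p - p') = skew q p - skew q p'"
  using skew_add[of q "p - p'" p'] by simp

lemma skew_0: "skew q 0 = 0"
  using skew_smult[of q 0 0] by simp

lemma skew_sum: "skew q (\<Sum>i\<in>A. f i) = (\<Sum>i\<in>A. skew q (f i))"
  by (induction A rule: infinite_finite_induct) (auto simp: skew_0 skew_add)

text \<open>If \<open>u = p exp (-x\<^sup>2/2)\<close> then \<open>u' = half_gauss_deriv p exp (-x\<^sup>2/2)\<close>, so the two halves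
  of the skew form agree after an integration by parts.\<close>

definition half_gauss_deriv :: "real poly \<Rightarrow> real poly" where
  "half_gauss_deriv p = pderiv p - [:0, 1:] * p"

text \<open>The two sides differ by a total derivative. This turns reproduction under the skew form
  into orthogonality under \<open>gauss\<close>.\<close>

lemma skew_eq_half_gauss_deriv: "skew q p = 2 * gauss (q * half_gauss_deriv p)"
proof -
  have "q * pderiv p - pderiv q * p =
      smult 2 (q * half_gauss_deriv p) - (pderiv (q * p) - [:0, 2:] * (q * p))"
    using smult_add_left[of 1 1 "q * half_gauss_deriv p"] smult_add_left[of 1 1 "[:0, 1:] * (q * p)"]
    by (simp add: half_gauss_deriv_def pderiv_mult algebra_simps)
  then show ?thesis
    unfolding skew_def by (simp only: gauss_diff gauss_smult gauss_pderiv)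
qed

lemma degree_half_gauss_deriv:
  assumes "degree p \<le> k"
  shows "degree (half_gauss_deriv p) \<le> Suc k"
    and "coeff (half_gauss_deriv p) (Suc k) = - coeff p k"
proof -
  have "degree (pderiv p) \<le> Suc k" "degree ([:0, 1:] * p) \<le> Suc k"
    using assms by (auto simp: degree_pderiv intro: order_trans[OF degree_pCons_le])
  then show "degree (half_gauss_deriv p) \<le> Suc k"
    unfolding half_gauss_deriv_def by (rule degree_diff_le)
  have "coeff p (Suc (Suc k)) = 0"
    using assms by (intro coeff_eq_0) simp
  then show "coeff (half_gauss_deriv p) (Suc k) = - coeff p k"
    by (simp add: half_gauss_deriv_def coeff_pderiv)
qed

section \<open>Averages over all but one eigenvalue\<close>

locale gse_ensemble =
  fixes m :: nat
begin

text \<open>The ensemble has \<open>Suc m\<close> eigenvalues; \<open>m\<close> of them are averaged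
  out, which accounts for the degrees \<open>2 * m\<close> below.\<close>

definition Z :: real where
  "Z = gse_partition_function (Suc m)"

definition moment :: "nat \<Rightarrow> nat \<Rightarrow> real" where
  "moment j k = (\<integral>l. coeff (sqpoly m l) j * coeff (sqpoly m l) k * gse_weight m l \<partial>lborel_power m)"

definition pair_basis :: "real \<Rightarrow> nat \<Rightarrow> nat \<Rightarrow> real poly" where
  "pair_basis x j k = smult (x ^ j) ([:- x, 1:] * monom 1 k)"

text \<open>The unnormalised average of \<open>skew_kernel m l x\<close> over \<open>l\<close>;
  expanding it in moments means that only real-valued functions are integrated.\<close>

definition mean_kernel :: "real \<Rightarrow> real poly" where
  "mean_kernel x = (\<Sum>j\<le>2*m. \<Sum>k\<le>2*m. smult (moment j k) (pair_basis x j k))"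

text \<open>Since \<open>sqpoly m l\<close> is monic of degree \<open>2 * m\<close>, \<open>moment (2*m) k\<close> is the integral of its
  \<open>k\<close>-th coefficient alone.\<close>

definition mean_sqpoly :: "real poly" where
  "mean_sqpoly = (\<Sum>k\<le>2*m. smult (moment (2*m) k) (monom 1 k))"

text \<open>The unnormalised average of the square of \<open>poly (sqpoly m l) x\<close>.\<close>

definition mean_square :: "real \<Rightarrow> real" where
  "mean_square x = (\<Sum>j\<le>2*m. \<Sum>k\<le>2*m. moment j k * x ^ (j + k))"

lemma Z_pos: "Z > 0"
  by (simp add: Z_def gse_partition_function_pos)

lemma sqpoly_eq_sum: "sqpoly m l = (\<Sum>k\<le>2*m. smult (coeff (sqpoly m l) k) (monom 1 k))"
  using poly_as_sum_of_monoms[of "sqpoly m l"] by (simp add: smult_monom degree_sqpoly)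

lemma poly_sqpoly: "poly (sqpoly m l) x = (\<Sum>k\<le>2*m. coeff (sqpoly m l) k * x ^ k)"
  by (simp add: poly_altdef degree_sqpoly)

lemma skew_kernel_eq_sum:
  "skew_kernel m l x =
    (\<Sum>j\<le>2*m. \<Sum>k\<le>2*m. smult (coeff (sqpoly m l) j * coeff (sqpoly m l) k) (pair_basis x j k))"
proof -
  have "skew_kernel m l x = (\<Sum>j\<le>2*m. smult (coeff (sqpoly m l) j * x ^ j) ([:- x, 1:] * sqpoly m l))"
    unfolding skew_kernel_def poly_sqpoly mult_smult_right
    by (induction "{..2*m}" rule: infinite_finite_induct) (auto simp: smult_sum)
  also have "\<dots> = (\<Sum>j\<le>2*m. \<Sum>k\<le>2*m.
      smult (coeff (sqpoly m l) j * coeff (sqpoly m l) k) (pair_basis x j k))"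
    by (subst (2) sqpoly_eq_sum)
       (simp add: pair_basis_def sum_distrib_left smult_sum_right mult_smult_right ac_simps del: mult_pCons_left)
  finally show ?thesis .
qed

lemma moment_integrable:
  "integrable (lborel_power m) (\<lambda>l. coeff (sqpoly m l) j * coeff (sqpoly m l) k * gse_weight m l)"
  by (intro gse_weight_integrable poly_bounded_mult poly_bounded_coeff_sqpoly)

lemma sqpoly_fun_upd: "sqpoly m (l(m := y)) = sqpoly m l"
  by (simp add: sqpoly_def)

lemma gse_weight_fun_upd: "gse_weight m (l(m := y)) = gse_weight m l"
  by (simp add: gse_weight_def)

lemma moment_separate:
  assumes "integrable lborel g"
  shows "integrable (lborel_power (Suc m))
      (\<lambda>l. coeff (sqpoly m l) j * coeff (sqpoly m l) k * gse_weight m l * g (l m))"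
    and "(\<integral>l. coeff (sqpoly m l) j * coeff (sqpoly m l) k * gse_weight m l * g (l m)
        \<partial>lborel_power (Suc m)) = moment j k * (\<integral>y. g y \<partial>lborel)"
  using integral_separate_last[OF moment_integrable _ assms, of j k]
  by (simp_all add: sqpoly_fun_upd gse_weight_fun_upd moment_def)

lemma moment_sum_separate:
  assumes g: "\<And>j k. integrable lborel (g j k)"
  shows "integrable (lborel_power (Suc m)) (\<lambda>l. \<Sum>j\<le>2*m. \<Sum>k\<le>2*m.
      coeff (sqpoly m l) j * coeff (sqpoly m l) k * gse_weight m l * g j k (l m))"
    and "(\<integral>l. (\<Sum>j\<le>2*m. \<Sum>k\<le>2*m.
      coeff (sqpoly m l) j * coeff (sqpoly m l) k * gse_weight m l * g j k (l m))
        \<partial>lborel_power (Suc m)) = (\<Sum>j\<le>2*m. \<Sum>k\<le>2*m. moment j k * (\<integral>y. g j k y \<partial>lborel))"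
  using moment_separate[OF g] by (simp_all add: Bochner_Integration.integral_sum)

lemma interpolation_term_eq_sum:
  "interpolation_term m q x l = (\<Sum>j\<le>2*m. \<Sum>k\<le>2*m.
    coeff (sqpoly m l) j * coeff (sqpoly m l) k * gse_weight m l *
    (poly (q * pderiv (pair_basis x j k) - pderiv q * pair_basis x j k) (l m) * exp (- (l m)\<^sup>2)))"
proof -
  show ?thesis
    unfolding interpolation_term_def skew_kernel_eq_sum pderiv_sum pderiv_smult poly_sum poly_smult
    by (simp add: sum_distrib_left right_diff_distrib left_diff_distrib sum_subtractf ac_simps)
qed

text \<open>Integrate \<open>weighted_interpolation\<close> over all eigenvalues. By exchange
  symmetry the \<open>Suc m\<close> summands contribute equally, and splitting off the last variable
  produces the skew form with the averaged kernel.\<close>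

lemma skew_mean_kernel:
  assumes q: "degree q \<le> 2 * m + 1"
  shows "poly q x * Z = real (Suc m) * skew q (mean_kernel x)"
proof -
  let ?F = "interpolation_term m q x"
  have F: "integrable (lborel_power (Suc m)) ?F"
    unfolding interpolation_term_eq_sum[abs_def]
    by (rule moment_sum_separate(1)[OF gaussian_poly_integrable])
  have F': "(\<integral>l. ?F l \<partial>lborel_power (Suc m)) = skew q (mean_kernel x)"
    unfolding interpolation_term_eq_sum moment_sum_separate(2)[OF gaussian_poly_integrable]
    by (simp add: mean_kernel_def skew_sum skew_smult) (simp add: skew_def gauss_def)
  have "poly q x * Z = (\<integral>l. poly q x * gse_weight (Suc m) l \<partial>lborel_power (Suc m))"
    by (simp add: Z_def gse_partition_function_def)
  also have "\<dots> = (\<Sum>i<Suc m. \<integral>l. ?F (l \<circ> Transposition.transpose i m) \<partial>lborel_power (Suc m))"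
    unfolding weighted_interpolation[OF q]
    by (intro Bochner_Integration.integral_sum integral_transpose F) simp
  also have "\<dots> = (\<Sum>i<Suc m. \<integral>l. ?F l \<partial>lborel_power (Suc m))"
    by (intro sum.cong refl integral_transpose F) simp
  finally show ?thesis
    by (simp add: F' del: sum.lessThan_Suc)
qed

lemma moment_commute: "moment j k = moment k j"
  by (simp add: moment_def mult.commute)

text \<open>Both sides of \<open>skew_mean_kernel\<close> are polynomials in \<open>x\<close>; this
  compares their coefficients of degree 2m+1.\<close>

lemma skew_mean_sqpoly:
  assumes q: "degree q \<le> 2 * m + 1"
  shows "coeff q (2 * m + 1) * Z = - real (Suc m) * skew q mean_sqpoly"
proof -
  define U where "U = (\<Sum>j\<le>2*m. \<Sum>k\<le>2*m. smult (moment j k)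
    (monom (skew q (monom 1 (Suc k))) j - monom (skew q (monom 1 k)) (Suc j)))"
  have b: "pair_basis x j k = smult (x ^ j) (monom 1 (Suc k)) - smult (x ^ Suc j) (monom 1 k)" for x j k
    by (simp add: pair_basis_def monom_Suc smult_diff_right mult.commute)
  have "poly (smult Z q) x = poly (smult (real (Suc m)) U) x" for x
    using skew_mean_kernel[OF q, of x]
    by (simp add: mean_kernel_def U_def skew_sum skew_smult skew_diff b poly_sum poly_monom ac_simps
        del: power_Suc)
  then have "smult Z q = smult (real (Suc m)) U"
    by (intro poly_eq_poly_eq_iff[THEN iffD1] ext)
  then have "coeff (smult Z q) (2 * m + 1) = coeff (smult (real (Suc m)) U) (2 * m + 1)"
    by simp
  moreover have "coeff U (2 * m + 1) = - skew q mean_sqpoly"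
  proof -
    \<comment> \<open>Only the part - x^(j+1) y^k of the basis element with j = 2m reaches this
      degree in x.\<close>
    have "coeff U (2 * m + 1) = (\<Sum>j\<le>2*m. if j = 2*m then - (\<Sum>k\<le>2*m. moment j k * skew q (monom 1 k)) else 0)"
      unfolding U_def coeff_sum by (intro sum.cong refl) (auto simp: sum_negf)
    also have "\<dots> = - skew q mean_sqpoly"
      by (simp add: mean_sqpoly_def skew_sum skew_smult)
    finally show ?thesis .
  qed
  ultimately show ?thesis by (simp add: algebra_simps)
qed

lemma mean_kernel_degree:
  "degree (mean_kernel x) \<le> 2 * m + 1"
  "coeff (mean_kernel x) (2 * m + 1) = poly mean_sqpoly x"
proof -
  have d: "degree ([:- x, 1:] * monom 1 k) \<le> Suc k" for k
    using degree_mult_le[of "[:- x, 1:]" "monom 1 k"] degree_monom_le[of "1::real" k] by simp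
  show "degree (mean_kernel x) \<le> 2 * m + 1"
    unfolding mean_kernel_def pair_basis_def
    by (intro degree_sum_le order_trans[OF degree_smult_le] order_trans[OF d]) auto
  have c: "coeff (pair_basis x j k) (2 * m + 1) = (if k = 2 * m then x ^ j else 0)" if "k \<le> 2 * m" for j k
    using that by (auto simp: pair_basis_def)
  have "coeff (mean_kernel x) (2 * m + 1) =
      (\<Sum>j\<le>2*m. \<Sum>k\<le>2*m. if k = 2 * m then moment j k * x ^ j else 0)"
    unfolding mean_kernel_def coeff_sum coeff_smult by (intro sum.cong refl) (subst c, auto)
  also have "\<dots> = (\<Sum>j\<le>2*m. moment j (2*m) * x ^ j)"
    by simp
  also have "\<dots> = poly mean_sqpoly x"
    by (simp add: mean_sqpoly_def poly_sum poly_monom moment_commute)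
  finally show "coeff (mean_kernel x) (2 * m + 1) = poly mean_sqpoly x" .
qed

lemma mean_sqpoly_degree: "degree mean_sqpoly \<le> 2 * m"
  unfolding mean_sqpoly_def
  by (intro degree_sum_le order_trans[OF degree_smult_le] order_trans[OF degree_monom_le]) auto

text \<open>The kernel vanishes on the diagonal because of its factor y - x, so only the derivative
  of that factor survives.\<close>

lemma mean_square_eq: "mean_square x = poly (half_gauss_deriv (mean_kernel x)) x"
proof -
  have 0: "poly (mean_kernel x) x = 0"
    by (simp add: mean_kernel_def pair_basis_def poly_sum)
  have "poly (pderiv (pair_basis x j k)) x = x ^ (j + k)" for j k
    unfolding pair_basis_def pderiv_smult pderiv_mult
    by (simp add: pderiv_pCons poly_monom power_add)
  then have "poly (pderiv (mean_kernel x)) x = mean_square x"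
    by (simp add: mean_kernel_def mean_square_def pderiv_sum pderiv_smult poly_sum)
  with 0 show ?thesis
    by (simp add: half_gauss_deriv_def)
qed

text \<open>Scaled so that \<open>ratio\<close> times
  \<open>half_gauss_deriv (mean_kernel x)\<close> reproduces under \<open>gauss\<close>; the 2 comes
  from \<open>skew_eq_half_gauss_deriv\<close>.\<close>

definition ratio :: real where
  "ratio = 2 * real (Suc m) / Z"

text \<open>Paired with any \<open>q\<close> of degree at most 2m+1, both sides give minus the
  coefficient of \<open>q\<close> in degree 2m+1, and both have degree at most 2m+1. Thus
  \<open>mean_sqpoly\<close> is, up to scale, the polynomial C.\<close>

lemma half_gauss_deriv_mean_sqpoly:
  "smult ratio (half_gauss_deriv mean_sqpoly) =
    smult (- (2 ^ (2 * m + 1)) / hnorm (2 * m + 1)) (hermite (2 * m + 1))"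
proof -
  define D where "D = smult ratio (half_gauss_deriv mean_sqpoly)
    + smult (2 ^ (2 * m + 1) / hnorm (2 * m + 1)) (hermite (2 * m + 1))"
  have "D = 0"
  proof (rule gauss_orthogonal_imp_0)
    show "degree D \<le> 2 * m + 1"
      unfolding D_def using degree_half_gauss_deriv(1)[OF mean_sqpoly_degree] degree_hermite_le[of "2*m+1"]
      by (intro degree_add_le order_trans[OF degree_smult_le]) (auto simp del: hermite.simps)
    fix q :: "real poly" assume q: "degree q \<le> 2 * m + 1"
    have "gauss (q * D) = (ratio / 2) * skew q mean_sqpoly
        + 2 ^ (2 * m + 1) / hnorm (2 * m + 1) * (coeff q (2 * m + 1) * fact (2 * m + 1) * sqrt pi)"
      unfolding D_def distrib_left mult_smult_right gauss_add gauss_smult skew_eq_half_gauss_deriv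
        gauss_mult_hermite[OF q] by simp
    also have "\<dots> = (ratio / 2) * skew q mean_sqpoly + coeff q (2 * m + 1)"
      using hnorm_pos[of "2*m+1"] by (simp add: hnorm_def del: fact_Suc)
    also have "\<dots> = 0"
      using skew_mean_sqpoly[OF q] Z_pos by (simp add: ratio_def field_simps)
    finally show "gauss (q * D) = 0" .
  qed
  then show ?thesis
    unfolding D_def by (simp add: add_eq_0_iff2 del: hermite.simps)
qed

text \<open>The left side has degree at most 2m+2. The multiple of
  \<open>hermite (2 * m + 2)\<close> removes its top coefficient without changing pairings with
  lower degrees; what is left reproduces all polynomials of degree at most 2m+1 and so is the
  Hermite kernel.\<close>

lemma half_gauss_deriv_mean_kernel:
  "smult ratio (half_gauss_deriv (mean_kernel x)) = hermite_kernel (2 * m + 2) x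
    - smult (ratio * poly mean_sqpoly x / 2 ^ (2 * m + 2)) (hermite (2 * m + 2))"
proof -
  define D where "D = smult ratio (half_gauss_deriv (mean_kernel x)) - hermite_kernel (2 * m + 2) x
    + smult (ratio * poly mean_sqpoly x / 2 ^ (2 * m + 2)) (hermite (2 * m + 2))"
  have dk: "degree (hermite_kernel (2 * m + 2) x) \<le> 2 * m + 1"
    using degree_hermite_kernel[of "2*m+1" x] by simp
  have "D = 0"
  proof (rule gauss_orthogonal_imp_0)
    have "degree D \<le> 2 * m + 2"
      unfolding D_def using degree_half_gauss_deriv(1)[OF mean_kernel_degree(1)[of x]] dk
        degree_hermite_le[of "2*m+2"]
      by (intro degree_add_le degree_diff_le order_trans[OF degree_smult_le]) (auto simp del: hermite.simps)
    moreover have "coeff D (2 * m + 2) = 0"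
      using degree_half_gauss_deriv(2)[OF mean_kernel_degree(1)[of x]] dk mean_kernel_degree(2)[of x]
        coeff_hermite[of "2*m+2"] coeff_eq_0[of "hermite_kernel (2 * m + 2) x" "2*m+2"]
      by (simp add: D_def del: hermite.simps)
    ultimately show "degree D \<le> 2 * m + 1"
      by (metis Suc_eq_plus1 add_2_eq_Suc' coeff_eq_0 degree_0 le_SucE le_degree leading_coeff_0_iff zero_le)
    fix q :: "real poly" assume q: "degree q \<le> 2 * m + 1"
    then have q': "degree q < 2 * m + 2" by simp
    have "gauss (q * hermite (2 * m + 2)) = 0"
      using q' gauss_mult_hermite[of q "2*m+2"] coeff_eq_0[OF q'] by simp
    then have "gauss (q * D) = (ratio / 2) * skew q (mean_kernel x) - poly q x"
      unfolding D_def distrib_left right_diff_distrib mult_smult_right gauss_add gauss_diff gauss_smult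
        skew_eq_half_gauss_deriv gauss_mult_hermite_kernel[OF q'] by simp
    also have "\<dots> = 0"
      using skew_mean_kernel[OF q, of x] Z_pos by (simp add: ratio_def field_simps)
    finally show "gauss (q * D) = 0" .
  qed
  then show ?thesis
    unfolding D_def by (simp add: algebra_simps del: hermite.simps)
qed

section \<open>The eigenvalue density and its differential equation\<close>

definition density_function :: "real \<Rightarrow> real" where
  "density_function x = ratio / 2 * mean_square x * exp (- x\<^sup>2)"

lemma gse_weight_Suc_eq_sum:
  "gse_weight (Suc m) l * g (l m) = (\<Sum>j\<le>2*m. \<Sum>k\<le>2*m.
    coeff (sqpoly m l) j * coeff (sqpoly m l) k * gse_weight m l *
    (l m ^ (j + k) * exp (- (l m)\<^sup>2) * g (l m)))"
  unfolding gse_weight_Suc poly_sqpoly power2_eq_square[of "sum _ _"] sum_product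
  by (simp add: sum_distrib_left sum_distrib_right power_add ac_simps)

lemma continuous_density_function: "continuous_on A density_function"
  unfolding density_function_def[abs_def] mean_square_def
  by (intro continuous_intros)

text \<open>The count is a sum of indicators. Exchange symmetry moves each to the last coordinate,
  and integrating out the other eigenvalues leaves the moments that make up
  \<open>mean_square\<close>.\<close>

lemma expected_count:
  "gse_expected_count (Suc m) a b = integral {a..b} density_function"
proof -
  let ?M = "lborel_power (Suc m)"
  define g where "g y = indicator {a..b} y / Z" for y :: real
  define G where "G l = gse_weight (Suc m) l * g (l m)" for l
  have mono: "integrable lborel (\<lambda>y. y ^ i * exp (- y\<^sup>2) * g y)" for i
  proof -
    have "integrable lborel (\<lambda>y. y ^ i * exp (- y\<^sup>2) * indicator {a..b} y)"
      using integrable_mult_indicator[OF _ gaussian_monomial_integrable[of i], of "{a..b}"]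
      by (simp add: mult.commute)
    then show ?thesis
      unfolding g_def by (simp add: times_divide_eq_right integrable_divide)
  qed
  have G: "integrable ?M G"
    and G': "(\<integral>l. G l \<partial>?M) =
      (\<Sum>j\<le>2*m. \<Sum>k\<le>2*m. moment j k * (\<integral>y. y ^ (j + k) * exp (- y\<^sup>2) * g y \<partial>lborel))"
    unfolding G_def[abs_def] gse_weight_Suc_eq_sum
    using moment_sum_separate[OF mono] by auto
  have W [measurable]: "gse_weight (Suc m) \<in> borel_measurable ?M" by (rule gse_weight_measurable)
  have count: "real (card {j. j < Suc m \<and> l j \<in> {a..b}}) = (\<Sum>j<Suc m. indicator {a..b} (l j))" for l :: "nat \<Rightarrow> real"
  proof -
    have "{j. j < Suc m \<and> l j \<in> {a..b}} = {j \<in> {..<Suc m}. l j \<in> {a..b}}" by auto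
    then show ?thesis
      by (simp add: indicator_def sum.If_cases Int_def del: sum.lessThan_Suc)
  qed
  have "gse_expected_count (Suc m) a b =
      (\<integral>l. (gse_weight (Suc m) l / Z) * (\<Sum>j<Suc m. indicator {a..b} (l j)) \<partial>?M)"
    unfolding gse_expected_count_def gse_def count
    by (subst integral_density)
       (auto simp: Z_def gse_weight_nonneg gse_partition_function_pos less_imp_le
         intro!: borel_measurable_sum simp del: sum.lessThan_Suc)
  also have "\<dots> = (\<integral>l. (\<Sum>j<Suc m. G (l \<circ> Transposition.transpose j m)) \<partial>?M)"
  proof (rule Bochner_Integration.integral_cong[OF refl])
    fix l
    have "G (l \<circ> Transposition.transpose j m) = gse_weight (Suc m) l / Z * indicator {a..b} (l j)"
      if "j < Suc m" for j
      using that by (simp add: G_def g_def gse_weight_symmetric bij_betw_transpose_all)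
    then show "(gse_weight (Suc m) l / Z) * (\<Sum>j<Suc m. indicator {a..b} (l j)) =
        (\<Sum>j<Suc m. G (l \<circ> Transposition.transpose j m))"
      by (simp add: sum_distrib_left del: sum.lessThan_Suc)
  qed
  also have "\<dots> = (\<Sum>j<Suc m. \<integral>l. G (l \<circ> Transposition.transpose j m) \<partial>?M)"
    by (intro Bochner_Integration.integral_sum integral_transpose G) simp
  also have "\<dots> = (\<Sum>j<Suc m. \<integral>l. G l \<partial>?M)"
    by (intro sum.cong refl integral_transpose G) simp
  also have "\<dots> = real (Suc m) * (\<integral>l. G l \<partial>?M)"
    by simp
  also have "\<dots> = (\<Sum>j\<le>2*m. \<Sum>k\<le>2*m.
      (\<integral>y. real (Suc m) * moment j k * (y ^ (j + k) * exp (- y\<^sup>2) * g y) \<partial>lborel))"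
    unfolding G' by (simp add: sum_distrib_left mult.assoc)
  also have "\<dots> = (\<integral>y. (\<Sum>j\<le>2*m. \<Sum>k\<le>2*m.
      real (Suc m) * moment j k * (y ^ (j + k) * exp (- y\<^sup>2) * g y)) \<partial>lborel)"
    using mono by (simp add: Bochner_Integration.integral_sum)
  also have "\<dots> = (LINT y:{a..b}|lborel. density_function y)"
  proof -
    have "ratio / 2 = real (Suc m) / Z" using Z_pos by (simp add: ratio_def field_simps)
    then show ?thesis
      unfolding set_lebesgue_integral_def density_function_def
      by (intro Bochner_Integration.integral_cong refl)
         (simp add: mean_square_def g_def sum_distrib_left sum_distrib_right
           sum_divide_distrib ac_simps del: of_nat_Suc)
  qed
  also have "\<dots> = integral {a..b} density_function"
    using continuous_density_function
    by (intro set_borel_integral_eq_integral(2) borel_integrable_atLeastAtMost')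
  finally show ?thesis .
qed

lemma gse_density_eq: "gse_density (Suc m) = density_function"
  unfolding gse_density_def
proof (rule the_equality)
  show "continuous_on UNIV density_function \<and>
    (\<forall>a b. a \<le> b \<longrightarrow> (density_function has_integral gse_expected_count (Suc m) a b) {a..b})"
    using continuous_density_function
    by (auto simp: expected_count intro!: integrable_integral integrable_continuous_real)
next
  fix r :: "real \<Rightarrow> real"
  assume r: "continuous_on UNIV r \<and>
    (\<forall>a b. a \<le> b \<longrightarrow> (r has_integral gse_expected_count (Suc m) a b) {a..b})"
  show "r = density_function"
  proof
    fix x
    have eq: "integral {x..u} r = integral {x..u} density_function" if "x \<le> u" for u
      using r that expected_count[of x u] by (metis integral_unique)
    \<comment> \<open>A one-sided derivative at the left endpoint recovers the value at
      \<open>x\<close>, as the integrals are prescribed for intervals with a \<le> b.\<close>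
    have D: "((\<lambda>u. integral {x..u} f) has_vector_derivative f x) (at x within {x..x+1})"
      if "continuous_on UNIV f" for f :: "real \<Rightarrow> real"
      using that by (intro integral_has_vector_derivative) (auto intro: continuous_on_subset)
    have "((\<lambda>u. integral {x..u} density_function) has_vector_derivative r x) (at x within {x..x+1})"
      using D[of r] r by (auto intro: has_vector_derivative_transform[rotated 2] simp: eq)
    from vector_derivative_unique_within[OF _ this D[OF continuous_density_function]]
    show "r x = density_function x"
      by (simp add: trivial_limit_within islimpt_Icc)
  qed
qed

lemma gse_density_ode:
  defines "N \<equiv> real (Suc m)"
  shows "(\<forall>k<5. \<forall>x. (deriv ^^ k) density_function differentiable (at x)) \<and>
    (\<forall>x. - (1/4) * (deriv ^^ 5) density_function x
      + 5 * (1/4 * x^2 - (N + 1/4)) * (deriv ^^ 3) density_function x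
      - 3/2 * x * (deriv ^^ 2) density_function x
      + (- (x^4) + (8 * N + 2) * x^2 - 16 * N^2 - 8 * N + 1/2) * deriv density_function x
      + x * (x^2 - (4 * N + 1)) * density_function x = 0)"
proof -
  \<comment> \<open>Here \<open>n\<close> is 2N - 1, one less than the n of the overview, so
    \<open>A\<close> and \<open>B\<close> below are H_{2N} and H_{2N-1}.\<close>
  define n where "n = 2 * m + 1"
  have n: "2 * m + 2 = Suc n" "2 * m + 1 = n" and N: "2 * real (Suc n) = 4 * N"
    by (simp_all add: n_def N_def)
  define h where "h = hnorm n"
  have h: "h > 0" by (simp add: h_def hnorm_pos)
  define e where "e x = exp (- x\<^sup>2 / 2)" for x :: real
  have e: "(e has_real_derivative - x * e x) (at x)" for x
    unfolding e_def[abs_def] by (auto intro!: derivative_eq_intros)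
  have ee: "exp (- x\<^sup>2) = e x * e x" for x
    by (simp add: e_def flip: exp_add)
  have P: "((\<lambda>x. poly p x * e x) has_real_derivative poly (half_gauss_deriv p) x * e x) (at x)" for p x
    by (auto intro!: derivative_eq_intros e simp: half_gauss_deriv_def algebra_simps)
  define A B where "A = hermite (Suc n)" and "B = hermite n"
  \<comment> \<open>This scale serves twice: it makes \<open>half_gauss_deriv C\<close> equal to
    \<open>B\<close>, and it turns the correction term of the kernel into the product of
    \<open>A\<close> and \<open>C\<close>.\<close>
  define C where "C = smult (- (4 * h / 2 ^ Suc n) * (ratio / 2)) mean_sqpoly"
  have dA: "half_gauss_deriv A = smult (4 * N) B - [:0, 1:] * A"
    unfolding half_gauss_deriv_def A_def B_def pderiv_hermite N ..
  have dB: "half_gauss_deriv B = [:0, 1:] * B - A"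
    by (simp add: half_gauss_deriv_def A_def B_def poly_eq_iff coeff_pCons split: nat.split)
  have dC: "half_gauss_deriv C = B"
  proof -
    have "half_gauss_deriv C = smult (- (4 * h / 2 ^ Suc n) / 2) (smult ratio (half_gauss_deriv mean_sqpoly))"
      by (simp add: C_def half_gauss_deriv_def pderiv_smult pderiv_minus smult_diff_right)
    also have "\<dots> = B"
      unfolding half_gauss_deriv_mean_sqpoly n
      using h by (simp add: B_def h_def del: hermite.simps)
    finally show ?thesis .
  qed
  \<comment> \<open>The Hermite kernel on the diagonal supplies the quadratic part by
    Christoffel-Darboux; the Gaussian is split evenly between the two factors of each
    product.\<close>
  have form: "density_function x = 1 / (4 * h) * (4 * N * (poly B x * e x)\<^sup>2
      - 2 * x * (poly A x * e x) * (poly B x * e x) + (poly A x * e x)\<^sup>2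
      + (poly A x * e x) * (poly C x * e x))" for x
  proof -
    have "ratio * mean_square x = poly (smult ratio (half_gauss_deriv (mean_kernel x))) x"
      by (simp add: mean_square_eq)
    also have "\<dots> = poly (hermite_kernel (Suc n) x) x
        - ratio * poly mean_sqpoly x / 2 ^ Suc n * poly A x"
      unfolding half_gauss_deriv_mean_kernel n by (simp add: A_def del: hermite.simps)
    finally have R: "ratio * mean_square x = poly (hermite_kernel (Suc n) x) x
        - ratio * poly mean_sqpoly x / 2 ^ Suc n * poly A x" .
    have "4 * h * density_function x = 2 * h * (ratio * mean_square x) * exp (- x\<^sup>2)"
      by (simp add: density_function_def)
    also have "\<dots> = (2 * h * poly (hermite_kernel (Suc n) x) x
        - 2 * h * (ratio * poly mean_sqpoly x / 2 ^ Suc n * poly A x)) * exp (- x\<^sup>2)"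
      unfolding R by (simp only: right_diff_distrib)
    also have "\<dots> = (4 * N * (poly B x)\<^sup>2 - 2 * x * poly A x * poly B x + (poly A x)\<^sup>2
        + poly A x * poly C x) * exp (- x\<^sup>2)"
      unfolding h_def christoffel_darboux_diagonal N A_def B_def C_def
      by (simp del: hermite.simps)
    finally show ?thesis
      unfolding ee using h by (simp add: field_simps power2_eq_square)
  qed
  show ?thesis
    by (rule fifth_order_ode_of_quadratic_form[OF _ _ _ form])
       (use P[of A] P[of B] P[of C] in \<open>simp_all add: dA dB dC algebra_simps\<close>)
qed

end

theorem mainTheorem8:
  fixes N :: nat
  assumes "N \<ge> 1"
  shows "(\<forall>k<5. \<forall>x::real. (deriv ^^ k) (gse_density N) differentiable (at x)) \<and>
    (\<forall>x::real.
      - (1/4) * (deriv ^^ 5) (gse_density N) x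
      + 5 * (1/4 * x^2 - (real N + 1/4)) * (deriv ^^ 3) (gse_density N) x
      - 3/2 * x * (deriv ^^ 2) (gse_density N) x
      + (- (x^4) + (8 * real N + 2) * x^2 - 16 * (real N)^2 - 8 * real N + 1/2)
          * deriv (gse_density N) x
      + x * (x^2 - (4 * real N + 1)) * gse_density N x = 0)"
proof -
  obtain m where N: "N = Suc m"
    using assms by (cases N) auto
  show ?thesis
    unfolding N gse_ensemble.gse_density_eq by (rule gse_ensemble.gse_density_ode)
qed

end
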